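(* Suppose that $\omega=\omega(n)\gg1$ and that the edge-probability $p=p(n)$ satisfies $(\log n)^{\omega}n^{-2/5}\le p\ll n^{-1/3}$, and write $p=n^{-2/5+\varepsilon}$ with $\varepsilon=\varepsilon(n)>0$. Then there is a choice of the real-valued parameter $\delta=\delta(n,p,\varepsilon)$ with $\delta=(1+o(1))\,5\varepsilon/2$ such that the following hold. (i) $\delta\in(0,1)$ and $n^{1-\delta}p\gg\log^2(n)$. (ii) The parameter $s=s(n,p,\delta)=\lfloor\delta\log_{1/(1-p)}(n)\rfloor$ satisfies $s\ge2$ for all sufficiently large $n$. (iii) With high probability, every useful set $W\subseteq V$ in $G_{n,p}$ contains a clique $K$ so that every vertex $v\in V\setminus W$ has at least one non-neighbor in $K$.
   Context: $G_{n,p}$ is the binomial random graph on vertex set $V=\{1,\dots,n\}$, in which each pair of vertices is an edge independently with probability $p=p(n)\in(0,1)$. All asymptotics are as $n\to\infty$; $f\ll g$ (equivalently $g\gg f$) means $f/g\to0$; $\log$ without base is the natural logarithm. "With high probability" means with probability tending to $1$ as $n\to\infty$. Given $\delta=\delta(n,p,\varepsilon)\in(0,1)$, let $s=\lfloor\delta\log_{1/(1-p)}(n)\rfloor$ and $$\tau=\tau(n,p,\delta):=\max\Bigl\{\tfrac{2\log n}{np},\ \sqrt{\tfrac{32\log^2(n)}{n^{1-\delta}p\,[1-\log(n)/(np)]}}\Bigr\},$$ which satisfies $\tau=o(1)$ when $n^{1-\delta}p\gg\log^2(n)$. A set $W\subseteq V$ is called useful (in the graph $G_{n,p}$, with respect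 to $\delta$) if $|V\setminus W|\ge\max\{s-1,1\}$ and every vertex $v\in V\setminus W$ has at least $$\ell_1(W):=\max\bigl\{(1-\tau)n^{1-\delta}/s,\ |W|-2np\bigr\}$$ many non-neighbors in $W$. *)

theory Defs
  imports
    "HOL-Probability.Probability"
    "HOL-Library.Landau_Symbols"
    "HOL-Library.Ramsey"
begin

text \<open>
  A graph on the vertex set \<open>{1..n}\<close> is represented by its edge set, a subset of
  \<open>[{1..n}]\<^bsup>2\<^esup>\<close> (the two-element subsets of \<open>{1..n}\<close>).
  Cliques are those of \<^theory>\<open>HOL-Library.Ramsey\<close>.
\<close>

abbreviation verts :: "nat \<Rightarrow> nat set" where
  "verts n \<equiv> {1..n}"

definition Gnp :: "nat \<Rightarrow> real \<Rightarrow> nat set set pmf" where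
  "Gnp n p = map_pmf (\<lambda>f. {e. f e}) (Pi_pmf ([verts n]\<^bsup>2\<^esup>) False (\<lambda>_. bernoulli_pmf p))"

definition nonneighbors :: "nat set set \<Rightarrow> nat \<Rightarrow> nat set \<Rightarrow> nat set" where
  "nonneighbors E v A = {w \<in> A. w \<noteq> v \<and> {v, w} \<notin> E}"

definition s_param :: "nat \<Rightarrow> real \<Rightarrow> real \<Rightarrow> int" where
  "s_param n p \<delta> = \<lfloor>\<delta> * log (1 / (1 - p)) (real n)\<rfloor>"

definition tau :: "nat \<Rightarrow> real \<Rightarrow> real \<Rightarrow> real" where
  "tau n p \<delta> =
     max (2 * ln (real n) / (real n * p))
         (sqrt (32 * (ln (real n))\<^sup>2 /
            (real n powr (1 - \<delta>) * p * (1 - ln (real n) / (real n * p)))))"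

definition ell1 :: "nat \<Rightarrow> real \<Rightarrow> real \<Rightarrow> nat set \<Rightarrow> real" where
  "ell1 n p \<delta> W =
     max ((1 - tau n p \<delta>) * real n powr (1 - \<delta>) / real_of_int (s_param n p \<delta>))
         (real (card W) - 2 * real n * p)"

definition useful :: "nat \<Rightarrow> real \<Rightarrow> real \<Rightarrow> nat set set \<Rightarrow> nat set \<Rightarrow> bool" where
  "useful n p \<delta> E W \<longleftrightarrow>
     W \<subseteq> verts n \<and>
     int (card (verts n - W)) \<ge> max (s_param n p \<delta> - 1) 1 \<and>
     (\<forall>v \<in> verts n - W. real (card (nonneighbors E v W)) \<ge> ell1 n p \<delta> W)"

end

theory Submission
  imports Defs "HOL-Real_Asymp.Real_Asymp"
begin

text \<open>
  The clique \<open>K\<close> can always be a triangle: a triangle in \<open>W\<close> is good if its vertices have no common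
  neighbour outside \<open>W\<close>. Fix \<open>W\<close> with \<open>w\<close> vertices and reveal all edges except those inside \<open>W\<close>.
  This determines the triples of vertices of \<open>W\<close> that are uncovered, i.e. not contained in the
  neighbourhood of an outside vertex, and the edges inside \<open>W\<close> are still independent. It remains
  to see that with overwhelming probability one of the uncovered triples spans a triangle. Let \<open>l\<close> be
  a lower bound for the number of non-neighbours in \<open>W\<close> of each outside vertex.

  There are at least \<open>l w\<^sup>2 / 54\<close> uncovered triples (\<open>many_uncovered_triples\<close>). Indeed, let \<open>v0\<close> be an
  outside vertex with the most neighbours in \<open>W\<close>, and count the triples that touch the set \<open>U\<close> of the
  at least \<open>l\<close> non-neighbours of \<open>v0\<close>. None of them is covered by \<open>v0\<close>. Codegrees are small, so
  any other vertex sees at most about half of \<open>W\<close>, and the few vertices that see a non-negligible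
  fraction of \<open>W\<close> have almost disjoint neighbourhoods; together they cover little more than a quarter
  of these triples. A typical vertex sees \<open>O(p w)\<close> vertices of \<open>W\<close>, and since \<open>n p\<^sup>3\<close> is small, all such
  vertices cover a small fraction. The vertices in between are controlled by the edge distribution of the
  random graph: all vertices that see far more than their share of \<open>W\<close> send only \<open>O(w log n)\<close>
  edges into it.

  The probability that no uncovered triple spans a triangle is bounded by a lower-tail estimate in the
  style of Janson and Boppana--Spencer, which follows from the Harris correlation inequality
  (\<open>harris_inequality\<close>, \<open>janson_product_bound\<close>). To have control over the dependencies, one passes to a
  subfamily in which no pair of vertices lies in many triples (\<open>exists_spread_family\<close>). The outcome
  (\<open>triangle_avoidance_bound\<close>) is a probability at most \<open>exp (- C min (l w\<^sup>2 p\<^sup>3) (l w p))\<close> for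
  some constant \<open>C > 0\<close>.

  A union bound over \<open>W\<close> needs this to be smaller than \<open>n\<close> to the power \<open>- 4 (w + 1)\<close>. Since \<open>w \<ge> l\<close>, it
  suffices that \<open>l\<^sup>2 p\<^sup>3\<close> and \<open>l p\<close> are large multiples of \<open>log n\<close>. For useful sets one may take
  \<open>l\<close> of order \<open>n\<^bsup>1-\<delta>\<^esup> p / log n\<close>, and then \<open>l\<^sup>2 p\<^sup>3\<close> is of order \<open>n\<^bsup>5\<epsilon>-2\<delta>\<^esup> / (log n)\<^sup>2\<close>: this is the reason
  for \<open>\<delta> \<approx> 5 \<epsilon> / 2\<close>. The choice \<open>\<delta> = 5 \<epsilon> / 2 - 2 log log n / log n\<close> makes \<open>l\<^sup>2 p\<^sup>3\<close> of order
  \<open>(log n)\<^sup>2\<close>, and the correction term is negligible against \<open>\<epsilon>\<close> because \<open>p \<ge> (log n)\<^bsup>\<omega>\<^esup> n\<^bsup>-2/5\<^esup>\<close> means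
  \<open>\<epsilon> \<ge> \<omega> log log n / log n\<close> with \<open>\<omega> \<rightarrow> \<infinity>\<close>.
\<close>

section \<open>Means over binomial random subsets\<close>

text \<open>
  The expectation of \<open>f S\<close> for a random \<open>S \<subseteq> I\<close> that contains each element of \<open>I\<close> independently
  with probability \<open>p\<close>. Written as an explicit finite sum, it satisfies a recursion in \<open>I\<close>
  (\<open>subset_mean_insert\<close>), so that independence and correlation statements become inductions.
\<close>

definition subset_mean :: "real \<Rightarrow> 'a set \<Rightarrow> ('a set \<Rightarrow> real) \<Rightarrow> real" where
  "subset_mean p I f = (\<Sum>S\<in>Pow I. p ^ card S * (1 - p) ^ card (I - S) * f S)"

lemma subset_mean_empty: "subset_mean p {} f = f {}"
  by (simp add: subset_mean_def)

lemma subset_mean_insert: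
  assumes "finite I" "x \<notin> I"
  shows "subset_mean p (insert x I) f =
    (1 - p) * subset_mean p I f + p * subset_mean p I (\<lambda>S. f (insert x S))"
proof -
  have inj: "inj_on (insert x) (Pow I)"
    using assms(2) by (auto simp: inj_on_def)
  have "subset_mean p (insert x I) f =
      (\<Sum>S\<in>Pow I. p ^ card S * (1 - p) ^ card (insert x I - S) * f S) +
      (\<Sum>S\<in>insert x ` Pow I. p ^ card S * (1 - p) ^ card (insert x I - S) * f S)"
    unfolding subset_mean_def Pow_insert using assms
    by (subst sum.union_disjoint) auto
  also have "(\<Sum>S\<in>Pow I. p ^ card S * (1 - p) ^ card (insert x I - S) * f S)
      = (1 - p) * subset_mean p I f"
    unfolding subset_mean_def sum_distrib_left
  proof (rule sum.cong)
    fix S assume "S \<in> Pow I"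
    then have "insert x I - S = insert x (I - S)" "x \<notin> I - S" "finite (I - S)"
      using assms by auto
    then show "p ^ card S * (1 - p) ^ card (insert x I - S) * f S =
        (1 - p) * (p ^ card S * (1 - p) ^ card (I - S) * f S)" by simp
  qed simp
  also have "(\<Sum>S\<in>insert x ` Pow I. p ^ card S * (1 - p) ^ card (insert x I - S) * f S)
      = p * subset_mean p I (\<lambda>S. f (insert x S))"
    unfolding subset_mean_def sum_distrib_left sum.reindex[OF inj] comp_def
  proof (rule sum.cong)
    fix S assume "S \<in> Pow I"
    then have "insert x I - insert x S = I - S" "x \<notin> S" "finite S"
      using assms by (auto intro: finite_subset)
    then show "p ^ card (insert x S) * (1 - p) ^ card (insert x I - insert x S) * f (insert x S) =
        p * (p ^ card S * (1 - p) ^ card (I - S) * f (insert x S))" by simp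
  qed simp
  finally show ?thesis .
qed

lemma subset_mean_cong:
  "(\<And>S. S \<subseteq> I \<Longrightarrow> f S = g S) \<Longrightarrow> subset_mean p I f = subset_mean p I g"
  by (simp add: subset_mean_def)

lemma subset_mean_mono:
  assumes "0 \<le> p" "p \<le> 1" "\<And>S. S \<subseteq> I \<Longrightarrow> f S \<le> g S"
  shows "subset_mean p I f \<le> subset_mean p I g"
  unfolding subset_mean_def using assms by (intro sum_mono mult_left_mono) auto

lemma subset_mean_add:
  "subset_mean p I (\<lambda>S. f S + g S) = subset_mean p I f + subset_mean p I g"
  by (simp add: subset_mean_def ring_distribs sum.distrib)

lemma subset_mean_diff:
  "subset_mean p I (\<lambda>S. f S - g S) = subset_mean p I f - subset_mean p I g"
  by (simp add: subset_mean_def ring_distribs sum_subtractf)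

lemma subset_mean_cmult:
  "subset_mean p I (\<lambda>S. c * f S) = c * subset_mean p I f"
  by (simp add: subset_mean_def sum_distrib_left mult_ac)

lemma subset_mean_sum:
  "subset_mean p I (\<lambda>S. \<Sum>i\<in>A. f i S) = (\<Sum>i\<in>A. subset_mean p I (f i))"
  unfolding subset_mean_def sum_distrib_left by (rule sum.swap)

lemma subset_mean_const: "finite I \<Longrightarrow> subset_mean p I (\<lambda>_. c) = c"
  by (induction I rule: finite_induct)
     (simp_all add: subset_mean_empty subset_mean_insert algebra_simps)

lemma subset_mean_nonneg:
  "0 \<le> p \<Longrightarrow> p \<le> 1 \<Longrightarrow> (\<And>S. S \<subseteq> I \<Longrightarrow> 0 \<le> f S) \<Longrightarrow> 0 \<le> subset_mean p I f"
  unfolding subset_mean_def by (intro sum_nonneg) auto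

text \<open>
  Independence: the elements of \<open>I\<close> can be revealed before those of \<open>J\<close>.
\<close>

lemma subset_mean_union:
  assumes "finite I" "finite J" "I \<inter> J = {}"
  shows "subset_mean p (I \<union> J) f = subset_mean p I (\<lambda>S. subset_mean p J (\<lambda>T. f (S \<union> T)))"
  using assms(1,3)
proof (induction I arbitrary: f rule: finite_induct)
  case empty
  then show ?case by (simp add: subset_mean_empty)
next
  case (insert x I)
  then show ?case
    using assms(2) by (simp add: subset_mean_insert)
qed

lemma subset_mean_subset:
  assumes "finite I" "Q \<subseteq> I"
  shows "subset_mean p I (\<lambda>S. of_bool (Q \<subseteq> S)) = p ^ card Q"
  using assms
proof (induction I arbitrary: Q rule: finite_induct)
  case empty
  then show ?case by (simp add: subset_mean_empty)
next
  case (insert x I)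
  have fQ: "finite Q" using insert.prems insert.hyps(1) by (auto intro: finite_subset)
  have eq: "Q \<subseteq> insert x S \<longleftrightarrow> Q - {x} \<subseteq> S" for S by auto
  have IH: "subset_mean p I (\<lambda>S. of_bool (Q - {x} \<subseteq> S)) = p ^ card (Q - {x})"
    using insert.prems by (intro insert.IH) auto
  show ?case
  proof (cases "x \<in> Q")
    case True
    then have "subset_mean p I (\<lambda>S. of_bool (Q \<subseteq> S)) = subset_mean p I (\<lambda>_. 0)"
      using insert.hyps by (intro subset_mean_cong) auto
    moreover have "card Q = Suc (card (Q - {x}))"
      using card_Suc_Diff1[OF fQ True] by simp
    ultimately show ?thesis
      using insert.hyps IH by (simp add: subset_mean_insert eq subset_mean_const)
  next
    case False
    then have "Q - {x} = Q" by auto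
    then show ?thesis
      using insert.hyps IH by (simp add: subset_mean_insert eq algebra_simps)
  qed
qed

lemma subset_mean_indep:
  assumes "finite I" "Q \<subseteq> I" "\<And>S. S \<subseteq> I \<Longrightarrow> g S = g (S - Q)"
  shows "subset_mean p I (\<lambda>S. of_bool (Q \<subseteq> S) * g S) = p ^ card Q * subset_mean p I g"
proof -
  have fin: "finite Q" "finite (I - Q)" and I: "I = Q \<union> (I - Q)"
    using assms by (auto intro: finite_subset)
  have un: "subset_mean p I h =
      subset_mean p Q (\<lambda>S. subset_mean p (I - Q) (\<lambda>T. h (S \<union> T)))" for h
    by (subst I, rule subset_mean_union) (use fin in auto)
  have g: "g (S \<union> T) = g T" if "S \<subseteq> Q" "T \<subseteq> I - Q" for S T
  proof -
    have "S \<union> T \<subseteq> I" "T \<subseteq> I" "S \<union> T - Q = T - Q" using that assms(2) by auto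
    then show ?thesis using assms(3)[of "S \<union> T"] assms(3)[of T] by simp
  qed
  have "subset_mean p I g = subset_mean p (I - Q) g"
    unfolding un[of g] using g fin
    by (subst subset_mean_cong[of _ _ "\<lambda>_. subset_mean p (I - Q) g"])
       (auto intro: subset_mean_cong simp: subset_mean_const)
  moreover have "subset_mean p I (\<lambda>S. of_bool (Q \<subseteq> S) * g S) =
      subset_mean p Q (\<lambda>S. subset_mean p (I - Q) g * of_bool (Q \<subseteq> S))"
    unfolding un[of "\<lambda>S. of_bool (Q \<subseteq> S) * g S"]
  proof (rule subset_mean_cong)
    fix S assume S: "S \<subseteq> Q"
    have "Q \<subseteq> S \<union> T \<longleftrightarrow> Q \<subseteq> S" if "T \<subseteq> I - Q" for T using that by auto
    then show "subset_mean p (I - Q) (\<lambda>T. of_bool (Q \<subseteq> S \<union> T) * g (S \<union> T)) =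
        subset_mean p (I - Q) g * of_bool (Q \<subseteq> S)"
      unfolding subset_mean_cmult[symmetric] mult.commute[of "subset_mean p (I - Q) g"]
      by (intro subset_mean_cong) (simp add: g[OF S])
  qed
  ultimately show ?thesis
    using fin by (simp add: subset_mean_cmult subset_mean_subset)
qed

lemma subset_mean_mgf:
  assumes "finite I" "Q \<subseteq> I"
  shows "subset_mean p I (\<lambda>S. a ^ card (S \<inter> Q)) = (1 - p + p * a) ^ card Q"
  using assms
proof (induction I arbitrary: Q rule: finite_induct)
  case empty
  then show ?case by (simp add: subset_mean_empty)
next
  case (insert x I)
  have fQ: "finite Q" using insert.prems insert.hyps(1) by (auto intro: finite_subset)
  have IH: "subset_mean p I (\<lambda>S. a ^ card (S \<inter> (Q - {x}))) = (1 - p + p * a) ^ card (Q - {x})"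
    using insert.prems by (intro insert.IH) auto
  have 1: "subset_mean p I (\<lambda>S. a ^ card (S \<inter> Q)) = subset_mean p I (\<lambda>S. a ^ card (S \<inter> (Q - {x})))"
    using insert.hyps by (intro subset_mean_cong arg_cong[where f="\<lambda>X. a ^ card X"]) auto
  show ?case
  proof (cases "x \<in> Q")
    case True
    have "subset_mean p I (\<lambda>S. a ^ card (insert x S \<inter> Q)) =
        subset_mean p I (\<lambda>S. a * a ^ card (S \<inter> (Q - {x})))"
    proof (rule subset_mean_cong)
      fix S assume "S \<subseteq> I"
      then have "insert x S \<inter> Q = insert x (S \<inter> (Q - {x}))" "x \<notin> S \<inter> (Q - {x})"
        using True insert.hyps by auto
      then show "a ^ card (insert x S \<inter> Q) = a * a ^ card (S \<inter> (Q - {x}))"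
        using fQ by simp
    qed
    moreover have "card Q = Suc (card (Q - {x}))"
      using card_Suc_Diff1[OF fQ True] by simp
    ultimately show ?thesis
      using insert.hyps by (simp add: subset_mean_insert 1 IH subset_mean_cmult algebra_simps)
  next
    case False
    then have "Q - {x} = Q" "insert x S \<inter> Q = S \<inter> Q" for S by auto
    then show ?thesis
      using insert.hyps IH by (simp add: subset_mean_insert algebra_simps)
  qed
qed

text \<open>
  Conditioning on whether \<open>x\<close> lies in the random set leaves a two-point Chebyshev sum
  inequality, because the two conditional means of \<open>f\<close> increase and those of \<open>g\<close> decrease.
\<close>

lemma harris_inequality:
  assumes "finite I" "0 \<le> p" "p \<le> 1"
    "\<And>S T. S \<subseteq> T \<Longrightarrow> T \<subseteq> I \<Longrightarrow> f S \<le> f T"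
    "\<And>S T. S \<subseteq> T \<Longrightarrow> T \<subseteq> I \<Longrightarrow> g T \<le> g S"
  shows "subset_mean p I (\<lambda>S. f S * g S) \<le> subset_mean p I f * subset_mean p I g"
  using assms(1,4,5)
proof (induction I arbitrary: f g rule: finite_induct)
  case empty
  then show ?case by (simp add: subset_mean_empty)
next
  case (insert x I)
  define a0 a1 b0 b1 where "a0 = subset_mean p I f"
    and "a1 = subset_mean p I (\<lambda>S. f (insert x S))"
    and "b0 = subset_mean p I g"
    and "b1 = subset_mean p I (\<lambda>S. g (insert x S))"
  have "a0 \<le> a1" "b1 \<le> b0"
    unfolding a0_def a1_def b0_def b1_def using assms(2,3)
    by (auto intro!: subset_mean_mono insert.prems)
  then have neg: "p * (1 - p) * ((a1 - a0) * (b1 - b0)) \<le> 0"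
    using assms(2,3) by (intro mult_nonneg_nonpos) auto
  have 0: "subset_mean p I (\<lambda>S. f S * g S) \<le> a0 * b0"
    unfolding a0_def b0_def
    by (rule insert.IH) (auto intro!: insert.prems)
  have 1: "subset_mean p I (\<lambda>S. f (insert x S) * g (insert x S)) \<le> a1 * b1"
    unfolding a1_def b1_def
    by (rule insert.IH) (auto intro!: insert.prems)
  have "subset_mean p (insert x I) (\<lambda>S. f S * g S) \<le> (1 - p) * (a0 * b0) + p * (a1 * b1)"
    unfolding subset_mean_insert[OF insert.hyps] using 0 1 assms(2,3)
    by (intro add_mono mult_left_mono) auto
  also have "\<dots> = ((1 - p) * a0 + p * a1) * ((1 - p) * b0 + p * b1)
      + p * (1 - p) * ((a1 - a0) * (b1 - b0))"
    by (simp add: algebra_simps)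
  also have "\<dots> \<le> ((1 - p) * a0 + p * a1) * ((1 - p) * b0 + p * b1)"
    using neg by simp
  finally show ?case
    unfolding subset_mean_insert[OF insert.hyps] a0_def a1_def b0_def b1_def .
qed

text \<open>
  The events \<open>Q \<subseteq> S\<close> are treated one after the other, as in the proof of Janson's inequality by
  Boppana and Spencer. Let \<open>X\<close> be the event that no earlier set is contained in \<open>S\<close>, and \<open>N\<close> the
  larger event that no earlier set disjoint from \<open>Q\<close> is. Then \<open>Q \<subseteq> S\<close> is independent of \<open>N\<close>, and
  Harris bounds the probability that \<open>N\<close> occurs, but \<open>S\<close> contains \<open>Q \<union> R\<close> for an earlier set \<open>R\<close>
  that meets \<open>Q\<close>. If these corrections amount to at most half of the main term, the conditional
  probability of \<open>Q \<subseteq> S\<close> given \<open>X\<close> is at least half of the unconditional one.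
\<close>

lemma janson_product_bound:
  assumes "finite I" "0 \<le> p" "p \<le> 1" "finite F" "\<And>Q. Q \<in> F \<Longrightarrow> Q \<subseteq> I"
    "\<And>Q. Q \<in> F \<Longrightarrow> (\<Sum>R\<in>{R \<in> F - {Q}. R \<inter> Q \<noteq> {}}. p ^ card (Q \<union> R)) \<le> p ^ card Q / 2"
  shows "subset_mean p I (\<lambda>S. of_bool (\<forall>Q\<in>F. \<not> Q \<subseteq> S)) \<le> (\<Prod>Q\<in>F. 1 - p ^ card Q / 2)"
  using assms(4-6)
proof (induction F rule: finite_induct)
  case empty
  then show ?case using assms(1) by (simp add: subset_mean_const)
next
  case (insert Q F)
  define X :: "'a set \<Rightarrow> real" where "X S = of_bool (\<forall>R\<in>F. \<not> R \<subseteq> S)" for S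
  define N :: "'a set \<Rightarrow> real" where "N S = of_bool (\<forall>R\<in>F. R \<inter> Q = {} \<longrightarrow> \<not> R \<subseteq> S)" for S
  define M where "M = {R \<in> F. R \<inter> Q \<noteq> {}}"
  have fM: "finite M" and QI: "Q \<subseteq> I"
    using insert by (auto simp: M_def)
  have M: "(\<Sum>R\<in>M. p ^ card (Q \<union> R)) \<le> p ^ card Q / 2"
  proof -
    have "{R \<in> insert Q F - {Q}. R \<inter> Q \<noteq> {}} = M"
      using insert.hyps by (auto simp: M_def)
    then show ?thesis using insert.prems(2)[of Q] by simp
  qed
  have IH: "subset_mean p I X \<le> (\<Prod>Q\<in>F. 1 - p ^ card Q / 2)"
    unfolding X_def
  proof (rule insert.IH)
    fix R assume R: "R \<in> F"
    have "(\<Sum>R'\<in>{R' \<in> F - {R}. R' \<inter> R \<noteq> {}}. p ^ card (R \<union> R')) \<le>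
        (\<Sum>R'\<in>{R' \<in> insert Q F - {R}. R' \<inter> R \<noteq> {}}. p ^ card (R \<union> R'))"
      using insert.hyps assms(2) by (intro sum_mono2) auto
    also have "\<dots> \<le> p ^ card R / 2" using insert.prems(2)[of R] R by simp
    finally show "(\<Sum>R'\<in>{R' \<in> F - {R}. R' \<inter> R \<noteq> {}}. p ^ card (R \<union> R')) \<le> p ^ card R / 2" .
  qed (use insert.prems in auto)
  have XN: "subset_mean p I X \<le> subset_mean p I N" and N0: "0 \<le> subset_mean p I N"
    using assms(2,3) by (auto intro!: subset_mean_mono subset_mean_nonneg simp: X_def N_def)
  have QN: "subset_mean p I (\<lambda>S. of_bool (Q \<subseteq> S) * N S) = p ^ card Q * subset_mean p I N"
  proof (rule subset_mean_indep[OF assms(1) QI])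
    fix S
    have "R \<subseteq> S \<longleftrightarrow> R \<subseteq> S - Q" if "R \<inter> Q = {}" for R using that by auto
    then show "N S = N (S - Q)" by (auto simp: N_def)
  qed
  have QRN: "subset_mean p I (\<lambda>S. of_bool (Q \<union> R \<subseteq> S) * N S) \<le> p ^ card (Q \<union> R) * subset_mean p I N"
    if "R \<in> M" for R
  proof -
    have "Q \<union> R \<subseteq> I" using that QI insert.prems by (auto simp: M_def)
    then have "p ^ card (Q \<union> R) = subset_mean p I (\<lambda>S. of_bool (Q \<union> R \<subseteq> S))"
      using assms(1) by (simp only: subset_mean_subset)
    moreover have "subset_mean p I (\<lambda>S. of_bool (Q \<union> R \<subseteq> S) * N S) \<le>
        subset_mean p I (\<lambda>S. of_bool (Q \<union> R \<subseteq> S)) * subset_mean p I N"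
    proof (rule harris_inequality[OF assms(1-3)])
      fix S T :: "'a set" assume "S \<subseteq> T"
      then show "of_bool (Q \<union> R \<subseteq> S) \<le> (of_bool (Q \<union> R \<subseteq> T) :: real)" by auto
      have "(\<forall>R\<in>F. R \<inter> Q = {} \<longrightarrow> \<not> R \<subseteq> T) \<longrightarrow> (\<forall>R\<in>F. R \<inter> Q = {} \<longrightarrow> \<not> R \<subseteq> S)"
        using \<open>S \<subseteq> T\<close> by blast
      then show "N T \<le> N S"
        by (cases "\<forall>R\<in>F. R \<inter> Q = {} \<longrightarrow> \<not> R \<subseteq> T") (simp_all only: N_def, simp_all)
    qed
    ultimately show ?thesis by simp
  qed
  have "(p ^ card Q / 2) * subset_mean p I X \<le> (p ^ card Q / 2) * subset_mean p I N"
    using XN assms(2) by (intro mult_left_mono) auto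
  also have "\<dots> \<le> (p ^ card Q - (\<Sum>R\<in>M. p ^ card (Q \<union> R))) * subset_mean p I N"
    using M N0 by (intro mult_right_mono) auto
  also have "\<dots> = subset_mean p I (\<lambda>S. of_bool (Q \<subseteq> S) * N S) -
      (\<Sum>R\<in>M. p ^ card (Q \<union> R) * subset_mean p I N)"
    by (simp only: QN left_diff_distrib sum_distrib_right)
  also have "\<dots> \<le> subset_mean p I (\<lambda>S. of_bool (Q \<subseteq> S) * N S) -
      (\<Sum>R\<in>M. subset_mean p I (\<lambda>S. of_bool (Q \<union> R \<subseteq> S) * N S))"
    using QRN by (intro diff_left_mono sum_mono) auto
  also have "\<dots> = subset_mean p I (\<lambda>S. of_bool (Q \<subseteq> S) * N S -
      (\<Sum>R\<in>M. of_bool (Q \<union> R \<subseteq> S) * N S))"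
    by (simp only: subset_mean_diff subset_mean_sum)
  also have "\<dots> \<le> subset_mean p I (\<lambda>S. of_bool (Q \<subseteq> S) * X S)"
  proof (rule subset_mean_mono[OF assms(2,3)])
    fix S
    let ?R = "\<Sum>R\<in>M. of_bool (Q \<union> R \<subseteq> S) * N S"
    have nn: "0 \<le> ?R" by (intro sum_nonneg) (simp add: N_def)
    show "of_bool (Q \<subseteq> S) * N S - ?R \<le> of_bool (Q \<subseteq> S) * X S"
    proof (cases "Q \<subseteq> S \<and> N S = 1 \<and> X S = 0")
      case True
      then obtain R where R: "R \<in> F" "R \<subseteq> S" by (auto simp: X_def split: if_splits)
      then have "R \<in> M" using True by (auto simp: N_def M_def split: if_splits)
      then have "of_bool (Q \<union> R \<subseteq> S) * N S \<le> ?R"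
        using fM by (intro member_le_sum) (auto simp: N_def)
      then show ?thesis using True R by simp
    next
      case False
      have "N S \<in> {0, 1}" "X S \<in> {0, 1}" by (auto simp: N_def X_def)
      then show ?thesis using False nn by (auto simp: of_bool_def)
    qed
  qed
  finally have key: "(p ^ card Q / 2) * subset_mean p I X \<le> subset_mean p I (\<lambda>S. of_bool (Q \<subseteq> S) * X S)" .
  have "subset_mean p I (\<lambda>S. of_bool (\<forall>R\<in>insert Q F. \<not> R \<subseteq> S)) =
      subset_mean p I X - subset_mean p I (\<lambda>S. of_bool (Q \<subseteq> S) * X S)"
    unfolding subset_mean_diff[symmetric] by (intro subset_mean_cong) (auto simp: X_def)
  also have "\<dots> \<le> (1 - p ^ card Q / 2) * subset_mean p I X"
    using key by (simp add: algebra_simps)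
  also have "\<dots> \<le> (1 - p ^ card Q / 2) * (\<Prod>Q\<in>F. 1 - p ^ card Q / 2)"
    using IH power_le_one[OF assms(2,3), of "card Q"] by (intro mult_left_mono) auto
  finally show ?case using insert.hyps by simp
qed

section \<open>Triples not covered by outside neighbourhoods\<close>

text \<open>
  Bonferroni: subtracting the pairwise intersections loses at most \<open>c\<close> for each pair.
\<close>

lemma sum_card_le_card_Union:
  fixes M :: "'a \<Rightarrow> 'b set" and c :: real
  assumes "finite S" "\<And>v. v \<in> S \<Longrightarrow> finite (M v)" "0 \<le> c"
    "\<And>u v. u \<in> S \<Longrightarrow> v \<in> S \<Longrightarrow> u \<noteq> v \<Longrightarrow> real (card (M u \<inter> M v)) \<le> c"
  shows "(\<Sum>v\<in>S. real (card (M v))) \<le> real (card (\<Union>v\<in>S. M v)) + (real (card S))\<^sup>2 * c"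
  using assms(1,2,4)
proof (induction S rule: finite_induct)
  case empty
  then show ?case by simp
next
  case (insert x S)
  let ?R = "\<Union>v\<in>S. M v"
  have fin: "finite (M x)" "finite ?R" using insert by auto
  have "M x \<inter> ?R = (\<Union>v\<in>S. M x \<inter> M v)" by auto
  then have "card (M x \<inter> ?R) \<le> (\<Sum>v\<in>S. card (M x \<inter> M v))"
    using card_UN_le[OF insert.hyps(1)] by metis
  then have "real (card (M x \<inter> ?R)) \<le> (\<Sum>v\<in>S. real (card (M x \<inter> M v)))"
    by (simp flip: of_nat_sum)
  also have "\<dots> \<le> (\<Sum>v\<in>S. c)"
    using insert.hyps by (intro sum_mono insert.prems) auto
  finally have inter: "real (card (M x \<inter> ?R)) \<le> real (card S) * c" by simp
  have "card (M x) + card ?R = card (M x \<union> ?R) + card (M x \<inter> ?R)"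
    by (rule card_Un_Int[OF fin])
  then have un: "real (card (M x)) + real (card ?R) = real (card (M x \<union> ?R)) + real (card (M x \<inter> ?R))"
    by (simp flip: of_nat_add)
  have IH: "(\<Sum>v\<in>S. real (card (M v))) \<le> real (card ?R) + (real (card S))\<^sup>2 * c"
    using insert.prems by (intro insert.IH) auto
  have "0 \<le> real (card S) * c" using assms(3) by simp
  then have "real (card S) * c + (real (card S))\<^sup>2 * c \<le> (1 + real (card S))\<^sup>2 * c"
    using assms(3) by (simp add: power2_eq_square algebra_simps)
  then show ?case using insert.hyps IH un inter by simp
qed

text \<open>
  The vertices \<open>v\<close> with more than \<open>4 p |B|\<close> neighbours in \<open>B\<close> form a set \<open>A\<close> with more than
  \<open>4 p |A| |B|\<close> edges into \<open>B\<close>. So the first term in the assumed bound accounts for less than half of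
  these edges, and the second term must account for the others. Its part \<open>4 |A| \<Lambda>\<close> is small as well,
  because \<open>4 \<Lambda> \<le> p |B|\<close>; what remains is of order \<open>|B| \<Lambda>\<close>.
\<close>

lemma heavy_edges_bound:
  fixes N :: "'a \<Rightarrow> 'b set" and p \<Lambda> :: real
  assumes "0 < p" "1 \<le> card B" "0 \<le> \<Lambda>" "4 * \<Lambda> \<le> p * card B"
    and edges: "\<And>A. A \<subseteq> X \<Longrightarrow> (\<Sum>v\<in>A. real (card (N v \<inter> B))) \<le>
      2 * p * card A * card B + 4 * (real (card A) + real (card B) + 1) * \<Lambda>"
  shows "(\<Sum>v\<in>{v \<in> X. 4 * p * card B < card (N v \<inter> B)}. real (card (N v \<inter> B))) \<le> 32 * real (card B) * \<Lambda>"
proof -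
  define A where "A = {v \<in> X. 4 * p * card B < card (N v \<inter> B)}"
  let ?a = "real (card A)" and ?b = "real (card B)" and ?e = "\<Sum>v\<in>A. real (card (N v \<inter> B))"
  have "?a * (4 * p * ?b) \<le> ?e"
    using sum_bounded_below[of A "4 * p * ?b" "\<lambda>v. real (card (N v \<inter> B))"]
    by (auto simp: A_def)
  moreover have "?e \<le> 2 * p * ?a * ?b + 4 * (?a + ?b + 1) * \<Lambda>"
    by (rule edges) (auto simp: A_def)
  moreover have "?a * (4 * \<Lambda>) \<le> ?a * (p * ?b)"
    using assms(4) by (intro mult_left_mono) auto
  moreover have "\<Lambda> * 1 \<le> \<Lambda> * ?b" using assms by (intro mult_left_mono) auto
  ultimately have "?e \<le> 32 * ?b * \<Lambda>" by (simp add: algebra_simps)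
  then show ?thesis by (simp add: A_def)
qed

text \<open>
  There are \<open>27\<close> ordered triples with entries in a given set of three elements.
\<close>

lemma card_triples_ge:
  assumes "\<And>u a b. (u, a, b) \<in> Tr \<Longrightarrow> {u, a, b} \<in> T" "finite T" "\<And>t. t \<in> T \<Longrightarrow> card t = 3"
  shows "card Tr \<le> 27 * card T"
proof -
  have "Tr \<subseteq> (\<Union>t\<in>T. t \<times> t \<times> t)"
  proof
    fix x assume "x \<in> Tr"
    then obtain u a b where "x = (u, a, b)" "(u, a, b) \<in> Tr" by (cases x) auto
    then show "x \<in> (\<Union>t\<in>T. t \<times> t \<times> t)" using assms(1)[of u a b] by blast
  qed
  moreover have "finite t" if "t \<in> T" for t
    using assms(3)[OF that] by (intro card_ge_0_finite) simp
  ultimately have "card Tr \<le> card (\<Union>t\<in>T. t \<times> t \<times> t)"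
    using assms(2) by (intro card_mono) auto
  also have "\<dots> \<le> (\<Sum>t\<in>T. card (t \<times> t \<times> t))" by (rule card_UN_le[OF assms(2)])
  also have "\<dots> = (\<Sum>t\<in>T. 27)" by (intro sum.cong) (auto simp: card_cartesian_product assms(3))
  finally show ?thesis by simp
qed

text \<open>
  Here \<open>X\<close> is the set of vertices outside \<open>W\<close>, \<open>N v\<close> the neighbourhood of \<open>v\<close> in \<open>W\<close>, and \<open>\<Lambda>\<close> stands
  for \<open>log n\<close>. Ordered triples \<open>(u, a, b)\<close> with \<open>u \<in> U = W - N v0\<close> and \<open>a, b \<in> W\<close> are counted, where
  \<open>v0\<close> has maximal degree into \<open>W\<close>. A vertex \<open>v\<close> covers \<open>E v = d v U * (d v W)\<^sup>2\<close> of them, where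
  \<open>d v B\<close> is the number of its neighbours in \<open>B\<close>. Vertices with \<open>d v W \<ge> w / \<Lambda>\<close> make up the set \<open>S\<close>;
  they cover at most \<open>3/10\<close> of all triples and the other vertices at most \<open>1/10\<close>.
\<close>

lemma many_uncovered_triples:
  fixes N :: "'a \<Rightarrow> 'b set" and \<Lambda> l c p :: real
  assumes fin: "finite X" "finite W" and "X \<noteq> {}" and N: "\<And>v. v \<in> X \<Longrightarrow> N v \<subseteq> W"
    and codeg: "\<And>u v. u \<in> X \<Longrightarrow> v \<in> X \<Longrightarrow> u \<noteq> v \<Longrightarrow> real (card (N u \<inter> N v)) \<le> c"
    and edges: "\<And>A B. A \<subseteq> X \<Longrightarrow> B \<subseteq> W \<Longrightarrow> (\<Sum>v\<in>A. real (card (N v \<inter> B))) \<le>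
      2 * p * card A * card B + 4 * (real (card A) + real (card B) + 1) * \<Lambda>"
    and nonnb: "\<And>v. v \<in> X \<Longrightarrow> l \<le> real (card (W - N v))"
    and params: "0 < p" "1000 \<le> \<Lambda>" "4 * \<Lambda> \<le> p * l" "4 * p * \<Lambda> < 1"
      "2000 * real (card X) * p ^ 3 \<le> 1" "0 \<le> c" "20000 * \<Lambda> ^ 4 * c \<le> l"
  shows "l * (real (card W))\<^sup>2 \<le> 54 * real (card {t \<in> [W]\<^bsup>3\<^esup>. \<forall>v\<in>X. \<not> t \<subseteq> N v})"
proof -
  define d where "d v B = real (card (N v \<inter> B))" for v B
  define w where "w = real (card W)"
  obtain v0 where v0: "v0 \<in> X" "\<And>v. v \<in> X \<Longrightarrow> d v W \<le> d v0 W"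
  proof -
    have "Max ((\<lambda>v. d v W) ` X) \<in> (\<lambda>v. d v W) ` X"
      using fin(1) \<open>X \<noteq> {}\<close> by (intro Max_in) auto
    then obtain v0 where "v0 \<in> X" "d v0 W = Max ((\<lambda>v. d v W) ` X)" by auto
    then show ?thesis using fin(1) that[of v0] by simp
  qed
  define U where "U = W - N v0"
  define k where "k = real (card U)"
  have UW: "U \<subseteq> W" "finite U" using fin by (auto simp: U_def)
  have lk: "l \<le> k" unfolding k_def U_def by (rule nonnb[OF v0(1)])
  have kw: "k \<le> w" unfolding k_def w_def using card_mono[OF fin(2) UW(1)] by simp
  have p1: "p < 1 / 4000"
  proof -
    have "p * 4000 \<le> p * (4 * \<Lambda>)" using params(1,2) by (intro mult_left_mono) auto
    also have "\<dots> = 4 * p * \<Lambda>" by simp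
    finally show ?thesis using params(4) by linarith
  qed
  have l0: "4000 \<le> l"
  proof (rule ccontr)
    assume "\<not> 4000 \<le> l"
    then have "p * l < p * 4000" using params(1) by simp
    then show False using params(2,3) p1 by simp
  qed
  have k0: "4000 \<le> k" and w0: "4000 \<le> w" using l0 lk kw by auto
  have pk: "4 * \<Lambda> \<le> p * k" "4 * \<Lambda> \<le> p * w"
    using lk kw params(1,3) by (smt (verit) mult_left_mono)+
  have dUW: "d v U \<le> d v W" for v
    unfolding d_def using UW fin by (intro of_nat_mono card_mono) auto
  have d0: "0 \<le> d v B" for v B by (simp add: d_def)
  \<comment> \<open>outside vertices that see more than four times the expected share of \<open>U\<close> or of \<open>W\<close>\<close>
  define AU where "AU = {v \<in> X. 4 * p * k < d v U}"
  define AW where "AW = {v \<in> X. 4 * p * w < d v W}"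
  have eU: "(\<Sum>v\<in>AU. d v U) \<le> 32 * k * \<Lambda>"
    unfolding AU_def d_def k_def
    using k0 pk params(1,2) UW fin
    by (intro heavy_edges_bound edges) (auto simp: k_def)
  have eW: "(\<Sum>v\<in>AW. d v W) \<le> 32 * w * \<Lambda>"
    unfolding AW_def d_def w_def
    using w0 pk params(1,2) fin
    by (intro heavy_edges_bound edges) (auto simp: w_def)
  define S where "S = {v \<in> X. w / \<Lambda> \<le> d v W}"
  have finA: "finite AU" "finite AW" "finite S" using fin by (auto simp: AU_def AW_def S_def)
  have SA: "S \<subseteq> AW"
  proof -
    have "4 * p * w < w / \<Lambda>"
      using params(2,4) w0 by (simp add: field_simps)
    then show ?thesis by (auto simp: S_def AW_def)
  qed
  have cardS: "real (card S) \<le> 32 * \<Lambda>\<^sup>2"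
  proof -
    have "real (card S) * (w / \<Lambda>) \<le> (\<Sum>v\<in>S. d v W)"
      by (rule sum_bounded_below) (auto simp: S_def)
    also have "\<dots> \<le> (\<Sum>v\<in>AW. d v W)" using SA finA d0 by (intro sum_mono2) auto
    finally have "real (card S) * (w / \<Lambda>) \<le> 32 * w * \<Lambda>" using eW by simp
    then have "w * real (card S) \<le> w * (32 * \<Lambda>\<^sup>2)"
      using params(2) by (simp add: field_simps power2_eq_square)
    then show ?thesis using w0 by simp
  qed
  have c1: "100 * c \<le> l" and c2: "10240 * \<Lambda> ^ 4 * c \<le> l"
  proof -
    have "1 \<le> \<Lambda> ^ 4" using params(2) by (intro one_le_power) simp
    then have "c * 1 \<le> c * \<Lambda> ^ 4" "0 \<le> c * \<Lambda> ^ 4"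
      using params(6) mult_left_mono[of 1 "\<Lambda> ^ 4" c] by simp_all
    then show "100 * c \<le> l" "10240 * \<Lambda> ^ 4 * c \<le> l"
      using params(6,7) by (simp_all add: algebra_simps)
  qed
  have dU_S: "(\<Sum>v\<in>S. d v U) \<le> 1.1 * k"
  proof -
    have "(\<Sum>v\<in>S. d v U) \<le> real (card (\<Union>v\<in>S. N v \<inter> U)) + (real (card S))\<^sup>2 * c"
      unfolding d_def
    proof (rule sum_card_le_card_Union)
      fix u v assume uv: "u \<in> S" "v \<in> S" "u \<noteq> v"
      then have "u \<in> X" "v \<in> X" by (auto simp: S_def)
      moreover have "finite (N u)" by (rule finite_subset[OF N[OF \<open>u \<in> X\<close>] fin(2)])
      then have "card (N u \<inter> U \<inter> (N v \<inter> U)) \<le> card (N u \<inter> N v)"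
        by (intro card_mono) auto
      ultimately show "real (card (N u \<inter> U \<inter> (N v \<inter> U))) \<le> c"
        using codeg[of u v] uv by simp
    qed (use finA UW params in auto)
    moreover have "real (card (\<Union>v\<in>S. N v \<inter> U)) \<le> k"
      unfolding k_def using UW by (intro of_nat_mono card_mono) auto
    moreover have "(real (card S))\<^sup>2 * c \<le> (32 * \<Lambda>\<^sup>2)\<^sup>2 * c"
      using cardS params(6) by (intro mult_right_mono power_mono) auto
    moreover have "(32 * \<Lambda>\<^sup>2)\<^sup>2 * c = 1024 * \<Lambda> ^ 4 * c"
      by (simp add: power2_eq_square eval_nat_numeral)
    ultimately show ?thesis using c2 lk by simp
  qed
  \<comment> \<open>the second largest degree: \<open>N v\<close> and \<open>N v0\<close> are almost disjoint, and \<open>N v0\<close> is at least as large\<close>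
  have half: "d v W \<le> 0.51 * w" if "v \<in> X" "v \<noteq> v0" for v
  proof -
    have f: "finite (N v)" "finite (N v0)" using N that v0 fin by (meson finite_subset)+
    have "card (N v) + card (N v0) = card (N v \<union> N v0) + card (N v \<inter> N v0)"
      by (rule card_Un_Int[OF f])
    moreover have "card (N v \<union> N v0) \<le> card W"
      using N that v0 fin by (intro card_mono) auto
    moreover have "real (card (N v \<inter> N v0)) \<le> c" using that v0 by (intro codeg) auto
    moreover have "N v \<inter> W = N v" "N v0 \<inter> W = N v0" using N that v0 by auto
    ultimately have "d v W + d v0 W \<le> w + c"
      unfolding d_def w_def by (simp only:)
    then show ?thesis using v0(2)[OF that(1)] c1 lk kw w0 by simp
  qed
  define E where "E v = d v U * (d v W)\<^sup>2" for v
  have Ev0: "E v0 = 0"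
  proof -
    have "N v0 \<inter> U = {}" by (auto simp: U_def)
    then show ?thesis by (simp add: E_def d_def)
  qed
  have E_S: "(\<Sum>v\<in>S - {v0}. E v) \<le> 0.3 * k * w\<^sup>2"
  proof -
    have "(\<Sum>v\<in>S - {v0}. E v) \<le> (\<Sum>v\<in>S - {v0}. d v U * (0.51 * w)\<^sup>2)"
      unfolding E_def using half d0 by (intro sum_mono mult_left_mono power_mono) (auto simp: S_def)
    also have "\<dots> \<le> (\<Sum>v\<in>S. d v U * (0.51 * w)\<^sup>2)"
      using finA d0 by (intro sum_mono2) auto
    also have "\<dots> = (\<Sum>v\<in>S. d v U) * (0.51 * w)\<^sup>2" by (simp add: sum_distrib_right)
    also have "\<dots> \<le> (1.1 * k) * (0.51 * w)\<^sup>2" by (intro mult_right_mono dU_S) auto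
    also have "\<dots> = 0.28611 * (k * w\<^sup>2)" by (simp add: power2_eq_square)
    also have "\<dots> \<le> 0.3 * (k * w\<^sup>2)" using k0 by (intro mult_right_mono) auto
    finally show ?thesis by simp
  qed
  have E_rest: "(\<Sum>v\<in>X - S. E v) \<le> 0.1 * k * w\<^sup>2"
  proof -
    \<comment> \<open>bounds for the share of a vertex in \<open>AU\<close>, in \<open>AW\<close> but not in \<open>AU\<close>, and in neither of the two\<close>
    define a1 a2 a3 where "a1 = (w / \<Lambda>)\<^sup>2" and "a2 = 4 * p * k * (w / \<Lambda>)"
      and "a3 = 4 * p * k * (4 * p * w)\<^sup>2"
    have a: "0 \<le> a1" "0 \<le> a2" "0 \<le> a3"
      using params k0 w0 by (auto simp: a1_def a2_def a3_def)
    have "E v \<le> a1 * (if v \<in> AU then d v U else 0) + a2 * (if v \<in> AW then d v W else 0) + a3"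
      if v: "v \<in> X - S" for v
    proof -
      have dv: "d v W \<le> w / \<Lambda>" using v by (auto simp: S_def)
      consider "v \<in> AU" | "v \<notin> AU" "v \<in> AW" | "v \<notin> AU" "v \<notin> AW" by blast
      then show ?thesis
      proof cases
        case 1
        have "E v \<le> d v U * (w / \<Lambda>)\<^sup>2"
          unfolding E_def using dv d0 by (intro mult_left_mono power_mono) auto
        moreover have "0 \<le> a2 * (if v \<in> AW then d v W else 0)" using a d0 by simp
        ultimately show ?thesis using 1 a by (simp add: a1_def mult.commute)
      next
        case 2
        then have "d v U \<le> 4 * p * k" using v by (auto simp: AU_def)
        then have "E v \<le> (4 * p * k) * ((w / \<Lambda>) * d v W)"
          unfolding E_def power2_eq_square using dv d0 k0 w0 params(1,2) by (intro mult_mono) auto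
        then show ?thesis using 2 a by (simp add: a2_def mult_ac)
      next
        case 3
        then have "d v U \<le> 4 * p * k" "d v W \<le> 4 * p * w" using v by (auto simp: AU_def AW_def)
        then have "E v \<le> a3"
          unfolding E_def a3_def using d0 k0 w0 params(1,2) by (intro mult_mono power_mono) auto
        then show ?thesis using 3 by simp
      qed
    qed
    then have "(\<Sum>v\<in>X - S. E v) \<le> (\<Sum>v\<in>X - S. a1 * (if v \<in> AU then d v U else 0)
        + a2 * (if v \<in> AW then d v W else 0) + a3)" by (rule sum_mono)
    also have "\<dots> \<le> (\<Sum>v\<in>X. a1 * (if v \<in> AU then d v U else 0)
        + a2 * (if v \<in> AW then d v W else 0) + a3)"
      using fin a d0 by (intro sum_mono2) auto
    also have "\<dots> = a1 * (\<Sum>v\<in>AU. d v U) + a2 * (\<Sum>v\<in>AW. d v W) + card X * a3"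
    proof -
      have "(\<Sum>v\<in>X. if v \<in> A then g v else 0) = sum g A" if "A \<subseteq> X" for A and g :: "'a \<Rightarrow> real"
        using that fin(1) by (simp add: sum.If_cases Int_absorb1)
      moreover have "AU \<subseteq> X" "AW \<subseteq> X" by (auto simp: AU_def AW_def)
      ultimately show ?thesis by (simp add: sum.distrib flip: sum_distrib_left)
    qed
    also have "\<dots> \<le> a1 * (32 * k * \<Lambda>) + a2 * (32 * w * \<Lambda>) + card X * a3"
      using a eU eW by (intro add_mono mult_left_mono) auto
    also have "\<dots> = (32 / \<Lambda> + 128 * p + 64 * (card X * p ^ 3)) * (k * w\<^sup>2)"
      using params(2) by (simp add: a1_def a2_def a3_def field_simps power2_eq_square eval_nat_numeral)
    also have "\<dots> \<le> 0.1 * (k * w\<^sup>2)"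
    proof (rule mult_right_mono)
      have "32 / \<Lambda> \<le> 0.032" using params(2) by (simp add: field_simps)
      then show "32 / \<Lambda> + 128 * p + 64 * (card X * p ^ 3) \<le> 0.1"
        using p1 params(5) by simp
    qed (use k0 in simp)
    finally show ?thesis by simp
  qed
  \<comment> \<open>the triples covered by some \<open>v \<in> X\<close>, and the triples with a repeated vertex\<close>
  define Cov where "Cov = (\<Union>v\<in>X. (N v \<inter> U) \<times> (N v \<inter> W) \<times> (N v \<inter> W))"
  define Dg where "Dg = (\<lambda>(u, b). (u, u, b)) ` (U \<times> W) \<union> (\<lambda>(u, b). (u, b, u)) ` (U \<times> W)
    \<union> (\<lambda>(u, b). (u, b, b)) ` (U \<times> W)"
  define Tr where "Tr = U \<times> W \<times> W - Cov - Dg"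
  have Cov: "real (card Cov) \<le> 0.4 * k * w\<^sup>2"
  proof -
    have "card Cov \<le> (\<Sum>v\<in>X. card ((N v \<inter> U) \<times> (N v \<inter> W) \<times> (N v \<inter> W)))"
      unfolding Cov_def by (rule card_UN_le[OF fin(1)])
    then have "real (card Cov) \<le> (\<Sum>v\<in>X. real (card ((N v \<inter> U) \<times> (N v \<inter> W) \<times> (N v \<inter> W))))"
      by (simp flip: of_nat_sum)
    also have "\<dots> = (\<Sum>v\<in>X. E v)"
      by (simp add: E_def d_def card_cartesian_product power2_eq_square)
    also have "\<dots> = (\<Sum>v\<in>S. E v) + (\<Sum>v\<in>X - S. E v)"
      using fin by (subst sum.subset_diff[of S X]) (auto simp: S_def)
    also have "(\<Sum>v\<in>S. E v) = (\<Sum>v\<in>S - {v0}. E v)"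
      using finA Ev0 by (intro sum.mono_neutral_right) auto
    finally show ?thesis using E_S E_rest by simp
  qed
  have Dg: "real (card Dg) \<le> 0.1 * k * w\<^sup>2"
  proof -
    have fUW: "finite (U \<times> W)" using UW fin by auto
    have "card Dg \<le> card (U \<times> W) + card (U \<times> W) + card (U \<times> W)"
      unfolding Dg_def
      by (intro order.trans[OF card_Un_le] add_mono card_image_le[OF fUW])
    then have "real (card Dg) \<le> real (3 * card (U \<times> W))" by (subst of_nat_le_iff) simp
    also have "\<dots> = 3 * (k * w)" by (simp add: k_def w_def card_cartesian_product)
    also have "\<dots> \<le> (0.1 * w) * (k * w)" using w0 k0 by (intro mult_right_mono) auto
    finally show ?thesis by (simp add: power2_eq_square mult_ac)
  qed
  have finO: "finite Tr" "finite Cov" "finite Dg"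
    using fin UW by (auto simp: Tr_def Cov_def Dg_def)
  have "U \<times> W \<times> W \<subseteq> Tr \<union> Cov \<union> Dg" by (auto simp: Tr_def)
  then have "card (U \<times> W \<times> W) \<le> card (Tr \<union> Cov \<union> Dg)"
    using finO by (intro card_mono) auto
  also have "\<dots> \<le> card Tr + card Cov + card Dg"
    by (intro order.trans[OF card_Un_le] add_mono card_Un_le order.refl)
  finally have "card (U \<times> W \<times> W) \<le> card Tr + card Cov + card Dg" .
  then have "k * w\<^sup>2 \<le> real (card Tr) + real (card Cov) + real (card Dg)"
    unfolding k_def w_def power2_eq_square card_cartesian_product of_nat_mult[symmetric]
      of_nat_add[symmetric] of_nat_le_iff .
  then have Tr: "0.5 * (k * w\<^sup>2) \<le> real (card Tr)" using Cov Dg by simp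
  define T where "T = {t \<in> [W]\<^bsup>3\<^esup>. \<forall>v\<in>X. \<not> t \<subseteq> N v}"
  have "card Tr \<le> 27 * card T"
  proof (rule card_triples_ge)
    show "finite T" using fin(2) by (simp add: T_def finite_imp_finite_nsets)
    show "\<And>t. t \<in> T \<Longrightarrow> card t = 3" by (simp add: T_def nsets_def)
    fix u a b assume o: "(u, a, b) \<in> Tr"
    then have mem: "u \<in> U" "a \<in> W" "b \<in> W" by (auto simp: Tr_def)
    have "u \<noteq> a" "u \<noteq> b" "a \<noteq> b" using o mem by (auto simp: Tr_def Dg_def)
    then have "{u, a, b} \<in> [W]\<^bsup>3\<^esup>" using mem UW by (auto simp: nsets_def)
    moreover have "\<not> {u, a, b} \<subseteq> N v" if "v \<in> X" for v
      using o mem that by (auto simp: Tr_def Cov_def)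
    ultimately show "{u, a, b} \<in> T" by (simp add: T_def)
  qed
  then have "real (card Tr) \<le> 27 * real (card T)" by linarith
  then have "k * w\<^sup>2 \<le> 54 * real (card T)" using Tr by simp
  moreover have "l * w\<^sup>2 \<le> k * w\<^sup>2" using lk by (intro mult_right_mono) auto
  ultimately show ?thesis unfolding w_def T_def by simp
qed

section \<open>Avoiding the triangles on a given family of triples\<close>

lemma card_triples_containing_pair:
  assumes "finite W" "e \<in> [W]\<^bsup>2\<^esup>"
  shows "card {t \<in> [W]\<^bsup>3\<^esup>. e \<subseteq> t} \<le> card W"
proof -
  have "{t \<in> [W]\<^bsup>3\<^esup>. e \<subseteq> t} \<subseteq> (\<lambda>x. insert x e) ` W"
  proof
    fix t assume t: "t \<in> {t \<in> [W]\<^bsup>3\<^esup>. e \<subseteq> t}"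
    then have "card (t - e) = 1"
      using assms(2) by (auto simp: nsets_def card_Diff_subset)
    then obtain x where "t - e = {x}" by (auto simp: card_1_singleton_iff)
    then have "t = insert x e" "x \<in> t" using t by auto
    moreover have "t \<subseteq> W" using t by (simp add: nsets_def)
    ultimately show "t \<in> (\<lambda>x. insert x e) ` W" by blast
  qed
  then show ?thesis using assms(1) by (rule surj_card_le[rotated])
qed

lemma sum_card_pairs_in_triples:
  assumes "finite W" "F \<subseteq> [W]\<^bsup>3\<^esup>"
  shows "(\<Sum>e\<in>[W]\<^bsup>2\<^esup>. card {t \<in> F. e \<subseteq> t}) = 3 * card F"
proof -
  have finF: "finite F" using assms by (meson finite_imp_finite_nsets finite_subset)
  have fin2: "finite ([W]\<^bsup>2\<^esup>)" using assms(1) by (rule finite_imp_finite_nsets)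
  have "(\<Sum>e\<in>[W]\<^bsup>2\<^esup>. card {t \<in> F. e \<subseteq> t}) = (\<Sum>t\<in>F. card {e \<in> [W]\<^bsup>2\<^esup>. e \<subseteq> t})"
    by (rule sum_multicount_gen[OF fin2 finF]) simp
  also have "\<dots> = (\<Sum>t\<in>F. 3)"
  proof (rule sum.cong)
    fix t assume "t \<in> F"
    then have t: "t \<subseteq> W" "card t = 3" "finite t" using assms(2) by (auto simp: nsets_def)
    then have "{e \<in> [W]\<^bsup>2\<^esup>. e \<subseteq> t} = {e. e \<subseteq> t \<and> card e = 2}"
      by (auto simp: nsets_def intro: finite_subset)
    then show "card {e \<in> [W]\<^bsup>2\<^esup>. e \<subseteq> t} = 3"
      using n_subsets[OF t(3), of 2] t(2) by (simp add: eval_nat_numeral)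
  qed simp
  finally show ?thesis by simp
qed

text \<open>
  Take \<open>F\<close> of maximal size. Then every triple of \<open>T\<close> outside \<open>F\<close> contains a saturated pair, one that
  lies in \<open>q\<close> triples of \<open>F\<close> already. Double counting gives at most \<open>3 |F| / q\<close> saturated pairs, each of
  which lies in at most \<open>|W|\<close> triples.
\<close>

lemma exists_spread_family:
  assumes "finite W" "T \<subseteq> [W]\<^bsup>3\<^esup>"
  obtains F where "F \<subseteq> T" "\<And>e. e \<in> [W]\<^bsup>2\<^esup> \<Longrightarrow> card {t \<in> F. e \<subseteq> t} \<le> q"
    "q * card T \<le> q * card F + 3 * card F * card W"
proof -
  define sp where "sp F \<longleftrightarrow> F \<subseteq> T \<and> (\<forall>e\<in>[W]\<^bsup>2\<^esup>. card {t \<in> F. e \<subseteq> t} \<le> q)" for F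
  have finT: "finite T" using assms by (meson finite_imp_finite_nsets finite_subset)
  have fin2: "finite ([W]\<^bsup>2\<^esup>)" using assms(1) by (rule finite_imp_finite_nsets)
  have "sp {}" by (simp add: sp_def)
  moreover have "card F \<le> card T" if "sp F" for F
    using that finT by (auto simp: sp_def intro: card_mono)
  ultimately obtain F where F: "sp F" "\<And>G. sp G \<Longrightarrow> card G \<le> card F"
    using ex_has_greatest_nat[of sp "{}" card "Suc (card T)"] by (auto simp: less_Suc_eq_le)
  have FT: "F \<subseteq> T" and finF: "finite F" and F3: "F \<subseteq> [W]\<^bsup>3\<^esup>"
    using F(1) finT assms(2) by (auto simp: sp_def intro: finite_subset)
  define Sat where "Sat = {e \<in> [W]\<^bsup>2\<^esup>. q \<le> card {t \<in> F. e \<subseteq> t}}"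
  have finSat: "finite Sat" using fin2 by (simp add: Sat_def)
  have "T - F \<subseteq> (\<Union>e\<in>Sat. {t \<in> [W]\<^bsup>3\<^esup>. e \<subseteq> t})"
  proof
    fix t assume t: "t \<in> T - F"
    have "\<not> sp (insert t F)" using F(2)[of "insert t F"] t finF by auto
    then obtain e where e: "e \<in> [W]\<^bsup>2\<^esup>" "q < card {t' \<in> insert t F. e \<subseteq> t'}"
      using t FT by (auto simp: sp_def not_le)
    have "e \<subseteq> t"
    proof (rule ccontr)
      assume "\<not> e \<subseteq> t"
      then have "{t' \<in> insert t F. e \<subseteq> t'} = {t' \<in> F. e \<subseteq> t'}" by auto
      then show False using e F(1) by (auto simp: sp_def)
    qed
    have "card {t' \<in> insert t F. e \<subseteq> t'} \<le> card (insert t {t' \<in> F. e \<subseteq> t'})"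
      using finF by (intro card_mono) auto
    also have "\<dots> \<le> Suc (card {t' \<in> F. e \<subseteq> t'})" by (rule card_insert_le_m1) auto
    finally have "e \<in> Sat" using e by (simp add: Sat_def)
    then show "t \<in> (\<Union>e\<in>Sat. {t \<in> [W]\<^bsup>3\<^esup>. e \<subseteq> t})" using \<open>e \<subseteq> t\<close> t assms(2) by auto
  qed
  then have "card (T - F) \<le> card (\<Union>e\<in>Sat. {t \<in> [W]\<^bsup>3\<^esup>. e \<subseteq> t})"
    using finSat assms(1) by (intro card_mono) (auto simp: finite_imp_finite_nsets)
  also have "\<dots> \<le> (\<Sum>e\<in>Sat. card {t \<in> [W]\<^bsup>3\<^esup>. e \<subseteq> t})" by (rule card_UN_le[OF finSat])
  also have "\<dots> \<le> (\<Sum>e\<in>Sat. card W)"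
    by (intro sum_mono card_triples_containing_pair assms(1)) (simp add: Sat_def)
  finally have 1: "card (T - F) \<le> card Sat * card W" by simp
  have "q * card Sat \<le> (\<Sum>e\<in>Sat. card {t \<in> F. e \<subseteq> t})"
    using sum_bounded_below[of Sat q "\<lambda>e. card {t \<in> F. e \<subseteq> t}"] by (simp add: Sat_def mult.commute)
  also have "\<dots> \<le> (\<Sum>e\<in>[W]\<^bsup>2\<^esup>. card {t \<in> F. e \<subseteq> t})"
    using fin2 by (intro sum_mono2) (auto simp: Sat_def)
  also have "\<dots> = 3 * card F" by (rule sum_card_pairs_in_triples[OF assms(1) F3])
  finally have 2: "q * card Sat \<le> 3 * card F" .
  have "q * card (T - F) \<le> q * card Sat * card W" using 1 by (simp add: mult.assoc)
  also have "\<dots> \<le> 3 * card F * card W" using 2 by (intro mult_right_mono) auto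
  finally have "q * card (T - F) \<le> 3 * card F * card W" .
  moreover have "card T = card (T - F) + card F"
    using FT finT finF by (simp add: card_Diff_subset card_mono)
  ultimately have "q * card T \<le> q * card F + 3 * card F * card W"
    by (simp add: add_mult_distrib2)
  with F(1) show ?thesis by (intro that[of F]) (auto simp: sp_def)
qed

text \<open>
  Two distinct triangles with a common edge have five edges in total, so each one contributes \<open>p\<^sup>5\<close> to the
  correction in \<open>janson_product_bound\<close>. A triangle shares an edge with at most \<open>3 q\<close> triangles of the
  family, and \<open>3 q p\<^sup>5 \<le> p\<^sup>3 / 2\<close>.
\<close>

lemma spread_triangles_bound:
  assumes "finite W" "0 \<le> p" "p \<le> 1" "F \<subseteq> [W]\<^bsup>3\<^esup>"
    "\<And>e. e \<in> [W]\<^bsup>2\<^esup> \<Longrightarrow> card {t \<in> F. e \<subseteq> t} \<le> q" "6 * real q * p\<^sup>2 \<le> 1"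
  shows "subset_mean p ([W]\<^bsup>2\<^esup>) (\<lambda>S. of_bool (\<forall>t\<in>F. \<not> [t]\<^bsup>2\<^esup> \<subseteq> S)) \<le> (1 - p ^ 3 / 2) ^ card F"
proof -
  define pr :: "'a set \<Rightarrow> 'a set set" where "pr t = [t]\<^bsup>2\<^esup>" for t
  have finF: "finite F" using assms(1,4) by (meson finite_imp_finite_nsets finite_subset)
  have fin2: "finite ([W]\<^bsup>2\<^esup>)" using assms(1) by (rule finite_imp_finite_nsets)
  have t3: "finite t" "card t = 3" "t \<subseteq> W" if "t \<in> F" for t
    using that assms(4) by (auto simp: nsets_def)
  have card_pr: "card (pr t) = card t choose 2" if "finite t" for t
    using n_subsets[OF that, of 2] that unfolding pr_def nsets_def
    by (simp add: finite_subset cong: conj_cong)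
  have card_pr3: "card (pr t) = 3" if "t \<in> F" for t
    using card_pr[of t] t3[OF that] by (simp add: eval_nat_numeral)
  have Un_pr: "\<Union>(pr t) = t" if "t \<in> F" for t
  proof
    show "\<Union>(pr t) \<subseteq> t" by (auto simp: pr_def nsets_def)
    show "t \<subseteq> \<Union>(pr t)"
    proof
      fix x assume x: "x \<in> t"
      have "t \<noteq> {x}" using t3[OF that] by auto
      then obtain y where "y \<in> t" "y \<noteq> x" using x by auto
      then have "{x, y} \<in> pr t" using x by (simp add: pr_def)
      then show "x \<in> \<Union>(pr t)" by blast
    qed
  qed
  then have inj: "inj_on pr F" by (metis inj_onI)
  have five: "5 \<le> card (pr t \<union> pr t')" if "t \<in> F" "t' \<in> F" "t \<noteq> t'" for t t'
  proof -
    have "pr t \<inter> pr t' = pr (t \<inter> t')" by (auto simp: pr_def nsets_def)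
    moreover have "card (t \<inter> t') < 3"
    proof (rule ccontr)
      assume "\<not> card (t \<inter> t') < 3"
      then have "t \<inter> t' = t" "t \<inter> t' = t'"
        using t3[OF that(1)] t3[OF that(2)] by (intro card_seteq; simp)+
      then show False using that by auto
    qed
    then have "card (t \<inter> t') = 0 \<or> card (t \<inter> t') = 1 \<or> card (t \<inter> t') = 2" by linarith
    then have "card (t \<inter> t') choose 2 \<le> 1"
      by (elim disjE) (simp_all add: binomial_eq_0)
    moreover have "finite (t \<inter> t')" using t3[OF that(1)] by simp
    ultimately have "card (pr t \<inter> pr t') \<le> 1" using card_pr[of "t \<inter> t'"] by simp
    moreover have "finite (pr t)" "finite (pr t')"
      using t3 that by (auto simp: pr_def intro: finite_imp_finite_nsets)
    then have "card (pr t) + card (pr t') = card (pr t \<union> pr t') + card (pr t \<inter> pr t')"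
      by (rule card_Un_Int)
    ultimately show ?thesis using card_pr3 that by simp
  qed
  have "subset_mean p ([W]\<^bsup>2\<^esup>) (\<lambda>S. of_bool (\<forall>Q\<in>pr ` F. \<not> Q \<subseteq> S)) \<le> (\<Prod>Q\<in>pr ` F. 1 - p ^ card Q / 2)"
  proof (rule janson_product_bound[OF fin2 assms(2,3)])
    show "finite (pr ` F)" using finF by simp
    fix Q assume "Q \<in> pr ` F"
    then obtain t where t: "t \<in> F" "Q = pr t" by auto
    show "Q \<subseteq> [W]\<^bsup>2\<^esup>" using t3[OF t(1)] t(2) by (auto simp: pr_def intro: nsets_mono[THEN subsetD])
    define M where "M = {R \<in> pr ` F - {Q}. R \<inter> Q \<noteq> {}}"
    have M: "M \<subseteq> pr ` (\<Union>e\<in>pr t. {t' \<in> F. e \<subseteq> t'})"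
      unfolding M_def t(2) by (auto simp: pr_def nsets_def)
    have prW: "pr t \<subseteq> [W]\<^bsup>2\<^esup>"
      unfolding pr_def by (rule nsets_mono[OF t3(3)[OF t(1)]])
    then have finpr: "finite (pr t)" using fin2 by (rule finite_subset)
    have "card M \<le> card (\<Union>e\<in>pr t. {t' \<in> F. e \<subseteq> t'})"
      by (rule surj_card_le[OF _ M]) (use finpr finF in auto)
    also have "\<dots> \<le> (\<Sum>e\<in>pr t. card {t' \<in> F. e \<subseteq> t'})" by (rule card_UN_le[OF finpr])
    also have "\<dots> \<le> (\<Sum>e\<in>pr t. q)" using prW by (intro sum_mono assms(5)) auto
    also have "\<dots> = 3 * q" using card_pr3[OF t(1)] by simp
    finally have cM: "real (card M) \<le> 3 * real q" by simp
    have "(\<Sum>R\<in>M. p ^ card (Q \<union> R)) \<le> (\<Sum>R\<in>M. p ^ 5)"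
    proof (rule sum_mono)
      fix R assume "R \<in> M"
      then obtain t' where "t' \<in> F" "R = pr t'" "R \<noteq> Q" by (auto simp: M_def)
      then have "5 \<le> card (Q \<union> R)" using five[of t t'] t by auto
      then show "p ^ card (Q \<union> R) \<le> p ^ 5" using assms(2,3) by (intro power_decreasing)
    qed
    also have "\<dots> = card M * p ^ 5" by simp
    also have "\<dots> \<le> (3 * real q) * p ^ 5" using cM assms(2) by (intro mult_right_mono) auto
    also have "\<dots> = (6 * real q * p\<^sup>2) * (p ^ 3 / 2)" by (simp add: eval_nat_numeral)
    also have "\<dots> \<le> 1 * (p ^ 3 / 2)" using assms(2,6) by (intro mult_right_mono) auto
    also have "\<dots> = p ^ card Q / 2" using card_pr3[OF t(1)] t(2) by simp
    finally show "(\<Sum>R\<in>{R \<in> pr ` F - {Q}. R \<inter> Q \<noteq> {}}. p ^ card (Q \<union> R)) \<le> p ^ card Q / 2"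
      by (simp add: M_def)
  qed
  also have "\<dots> = (\<Prod>t\<in>F. 1 - p ^ 3 / 2)"
    by (subst prod.reindex[OF inj]) (auto simp: card_pr3 intro: prod.cong)
  finally show ?thesis by (simp add: pr_def)
qed

text \<open>
  The spread subfamily of \<open>T\<close> is taken for the largest \<open>q\<close> allowed in \<open>spread_triangles_bound\<close>, which is
  of order \<open>1 / p\<^sup>2\<close>; it retains at least a proportion \<open>1 / (1 + 36 |W| p\<^sup>2)\<close> of \<open>T\<close>.
\<close>

lemma triangle_avoidance_bound:
  fixes p :: real
  assumes "finite W" "0 < p" "12 * p\<^sup>2 \<le> 1" "T \<subseteq> [W]\<^bsup>3\<^esup>"
  shows "subset_mean p ([W]\<^bsup>2\<^esup>) (\<lambda>S. of_bool (\<forall>t\<in>T. \<not> [t]\<^bsup>2\<^esup> \<subseteq> S))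
    \<le> exp (- (real (card T) * p ^ 3 / (2 * (1 + 36 * real (card W) * p\<^sup>2))))"
proof -
  have p1: "p \<le> 1"
  proof (rule ccontr)
    assume "\<not> p \<le> 1"
    then have "1 < p\<^sup>2" by (simp add: one_less_power)
    then show False using assms(3) by simp
  qed
  define q where "q = nat \<lfloor>1 / (6 * p\<^sup>2)\<rfloor>"
  have pp: "0 < p\<^sup>2" using assms(2) by simp
  have q6: "6 * real q * p\<^sup>2 \<le> 1"
  proof -
    have "real q \<le> 1 / (6 * p\<^sup>2)" unfolding q_def using pp by (simp add: of_nat_floor)
    then show ?thesis using pp by (simp add: field_simps)
  qed
  have q12: "1 \<le> 12 * p\<^sup>2 * real q"
  proof -
    have "1 / (6 * p\<^sup>2) \<le> real q + 1" unfolding q_def using pp by linarith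
    then have "1 \<le> 6 * p\<^sup>2 * real q + 6 * p\<^sup>2" using pp by (simp add: field_simps)
    then show ?thesis using assms(3) by simp
  qed
  then have q0: "0 < real q" using pp by (cases "q = 0") auto
  obtain F where F: "F \<subseteq> T" "\<And>e. e \<in> [W]\<^bsup>2\<^esup> \<Longrightarrow> card {t \<in> F. e \<subseteq> t} \<le> q"
    "q * card T \<le> q * card F + 3 * card F * card W"
    using exists_spread_family[OF assms(1,4)] by blast
  let ?f = "real (card F)" and ?w = "real (card W)" and ?x = "1 + 36 * real (card W) * p\<^sup>2"
  have "real (q * card T) \<le> real (q * card F + 3 * card F * card W)"
    by (rule of_nat_mono[OF F(3)])
  then have "real q * card T \<le> real q * ?f + 3 * ?f * ?w" by simp
  also have "\<dots> \<le> real q * ?f + 3 * ?f * ?w * (12 * p\<^sup>2 * real q)"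
    using q12 mult_left_mono[of 1 "12 * p\<^sup>2 * real q" "3 * ?f * ?w"] by simp
  also have "\<dots> = real q * (?f * ?x)" by (simp add: algebra_simps)
  finally have T: "real (card T) \<le> ?f * ?x" using q0 by simp
  have x: "0 < ?x" by (intro add_pos_nonneg) auto
  have "subset_mean p ([W]\<^bsup>2\<^esup>) (\<lambda>S. of_bool (\<forall>t\<in>T. \<not> [t]\<^bsup>2\<^esup> \<subseteq> S))
      \<le> subset_mean p ([W]\<^bsup>2\<^esup>) (\<lambda>S. of_bool (\<forall>t\<in>F. \<not> [t]\<^bsup>2\<^esup> \<subseteq> S))"
    using assms(2) p1 F(1) by (intro subset_mean_mono) auto
  also have "\<dots> \<le> (1 - p ^ 3 / 2) ^ card F"
    using assms p1 F q6 by (intro spread_triangles_bound[where q = q]) auto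
  also have "\<dots> \<le> exp (- (p ^ 3 / 2)) ^ card F"
    using exp_ge_add_one_self[of "- (p ^ 3 / 2)"] power_le_one[of p 3] assms(2) p1
    by (intro power_mono) auto
  also have "\<dots> = exp (- (?f * (p ^ 3 / 2)))" by (simp flip: exp_of_nat_mult)
  also have "\<dots> \<le> exp (- (card T * p ^ 3 / (2 * ?x)))"
  proof -
    have "card T * (p ^ 3 / 2) \<le> (?f * ?x) * (p ^ 3 / 2)"
      using T assms(2) by (intro mult_right_mono) auto
    then have "card T * p ^ 3 / (2 * ?x) \<le> ?f * (p ^ 3 / 2)"
      using x by (simp add: divide_le_eq algebra_simps)
    then show ?thesis by simp
  qed
  finally show ?thesis by (simp add: mult_ac)
qed

section \<open>Tail bounds for degrees and codegrees in the random graph\<close>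

text \<open>
  This turns every probability in the random graph into a mean over random sets of edges.
\<close>

lemma Gnp_prob_eq_subset_mean:
  assumes "0 \<le> p" "p \<le> 1"
  shows "measure_pmf.prob (Gnp n p) X = subset_mean p ([verts n]\<^bsup>2\<^esup>) (\<lambda>S. of_bool (S \<in> X))"
proof -
  let ?I = "[verts n]\<^bsup>2\<^esup>"
  have finI: "finite ?I" by (simp add: finite_imp_finite_nsets)
  have pmf: "pmf (Gnp n p) S = (if S \<subseteq> ?I then p ^ card S * (1 - p) ^ card (?I - S) else 0)" for S
  proof -
    have "pmf (Gnp n p) S = pmf (map_pmf Collect (Pi_pmf ?I False (\<lambda>_. bernoulli_pmf p))) (Collect (\<lambda>e. e \<in> S))"
      by (simp add: Gnp_def)
    also have "\<dots> = pmf (Pi_pmf ?I False (\<lambda>_. bernoulli_pmf p)) (\<lambda>e. e \<in> S)"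
      by (rule pmf_map_inj') (auto simp: inj_on_def)
    also have "\<dots> = (if S \<subseteq> ?I then \<Prod>e\<in>?I. pmf (bernoulli_pmf p) (e \<in> S) else 0)"
      using finI by (auto simp: pmf_Pi)
    also have "\<dots> = (if S \<subseteq> ?I then p ^ card S * (1 - p) ^ card (?I - S) else 0)"
    proof (rule if_cong)
      assume S: "S \<subseteq> ?I"
      have "(\<Prod>e\<in>?I. pmf (bernoulli_pmf p) (e \<in> S)) =
          (\<Prod>e\<in>S. pmf (bernoulli_pmf p) (e \<in> S)) * (\<Prod>e\<in>?I - S. pmf (bernoulli_pmf p) (e \<in> S))"
        by (subst prod.subset_diff[OF S finI]) (rule mult.commute)
      also have "\<dots> = p ^ card S * (1 - p) ^ card (?I - S)"
        using assms by simp
      finally show "(\<Prod>e\<in>?I. pmf (bernoulli_pmf p) (e \<in> S)) = p ^ card S * (1 - p) ^ card (?I - S)" .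
    qed auto
    finally show ?thesis .
  qed
  have "set_pmf (Gnp n p) \<subseteq> Pow ?I" by (auto simp: set_pmf_iff pmf split: if_splits)
  then have "measure_pmf.prob (Gnp n p) X = measure_pmf.prob (Gnp n p) (X \<inter> Pow ?I)"
    by (intro measure_prob_cong_0) (auto simp: pmf)
  also have "\<dots> = (\<Sum>S\<in>X \<inter> Pow ?I. pmf (Gnp n p) S)"
    using finI by (intro measure_measure_pmf_finite) auto
  also have "\<dots> = (\<Sum>S\<in>Pow ?I. if S \<in> X then pmf (Gnp n p) S else 0)"
    using finI by (subst Int_commute, intro sum.inter_restrict) simp
  also have "\<dots> = subset_mean p ?I (\<lambda>S. of_bool (S \<in> X))"
    unfolding subset_mean_def by (intro sum.cong) (auto simp: pmf)
  finally show ?thesis .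
qed

text \<open>
  Markov's inequality for \<open>exp (f S)\<close>. The exponent \<open>1\<close> is good enough here: all deviations that matter
  are at least a constant factor above the mean.
\<close>

lemma exp_moment_bound:
  assumes "finite I" "0 \<le> p" "p \<le> 1"
    "subset_mean p I (\<lambda>S. exp 1 ^ f S) \<le> exp b"
  shows "subset_mean p I (\<lambda>S. of_bool (b + y < real (f S))) \<le> exp (- y)"
proof -
  have "subset_mean p I (\<lambda>S. of_bool (b + y < real (f S))) \<le> subset_mean p I (\<lambda>S. exp (- b - y) * exp 1 ^ f S)"
  proof (rule subset_mean_mono[OF assms(2,3)])
    fix S
    have "exp (- b - y) * exp 1 ^ f S = exp (real (f S) - b - y)"
      by (simp flip: exp_of_nat_mult exp_add)
    then show "of_bool (b + y < real (f S)) \<le> exp (- b - y) * exp 1 ^ f S" by auto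
  qed
  also have "\<dots> = exp (- b - y) * subset_mean p I (\<lambda>S. exp 1 ^ f S)" by (rule subset_mean_cmult)
  also have "\<dots> \<le> exp (- b - y) * exp b" by (intro mult_left_mono assms(4)) simp
  also have "\<dots> = exp (- y)" by (simp flip: exp_add)
  finally show ?thesis .
qed

lemma mgf_le_exp:
  fixes a p :: real
  assumes "0 \<le> p" "p \<le> 1" "1 \<le> a"
  shows "(1 - p + p * a) ^ m \<le> exp (p * (a - 1) * real m)"
proof -
  have "1 - p + p * a = 1 + p * (a - 1)" by (simp add: algebra_simps)
  then have "1 - p + p * a \<le> exp (p * (a - 1))"
    using exp_ge_add_one_self[of "p * (a - 1)"] by (rule ord_eq_le_trans)
  moreover have "0 \<le> 1 - p + p * a" using assms by simp
  ultimately have "(1 - p + p * a) ^ m \<le> exp (p * (a - 1)) ^ m" by (rule power_mono)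
  then show ?thesis by (simp flip: exp_of_nat_mult add: mult_ac)
qed

lemma edge_count_tail:
  assumes "finite I" "Q \<subseteq> I" "0 \<le> p" "p \<le> 1"
  shows "subset_mean p I (\<lambda>S. of_bool (2 * p * real (card Q) + y < real (card (S \<inter> Q)))) \<le> exp (- y)"
proof (rule exp_moment_bound[OF assms(1,3,4)])
  have "subset_mean p I (\<lambda>S. exp 1 ^ card (S \<inter> Q)) \<le> exp (p * (exp 1 - 1) * real (card Q))"
    unfolding subset_mean_mgf[OF assms(1,2)] using assms by (intro mgf_le_exp) auto
  also have "\<dots> \<le> exp (2 * p * real (card Q))"
  proof -
    have "exp 1 - 1 \<le> (2::real)" using exp_le by simp
    then have "(exp 1 - 1) * (p * real (card Q)) \<le> 2 * (p * real (card Q))"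
      using assms by (intro mult_right_mono) auto
    then show ?thesis by (simp add: mult_ac)
  qed
  finally show "subset_mean p I (\<lambda>S. exp 1 ^ card (S \<inter> Q)) \<le> exp (2 * p * real (card Q))" .
qed

definition nbrs :: "nat set set \<Rightarrow> nat \<Rightarrow> nat set \<Rightarrow> nat set" where
  "nbrs E v B = {w \<in> B. {v, w} \<in> E}"

lemma edges_between_tail:
  assumes "0 \<le> p" "p \<le> 1" "A \<subseteq> verts n" "B \<subseteq> verts n" "A \<inter> B = {}"
  shows "subset_mean p ([verts n]\<^bsup>2\<^esup>)
    (\<lambda>S. of_bool (2 * p * real (card A) * real (card B) + y < (\<Sum>v\<in>A. real (card (nbrs S v B))))) \<le> exp (- y)"
proof -
  define Q where "Q = (\<lambda>(a, b). {a, b}) ` (A \<times> B)"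
  have fin: "finite A" "finite B" using assms(3,4) by (meson finite_atLeastAtMost finite_subset)+
  have inj: "inj_on (\<lambda>(a, b). {a, b}) (A \<times> B)"
    using assms(5) by (auto simp: inj_on_def doubleton_eq_iff)
  have cardQ: "card Q = card A * card B"
    unfolding Q_def by (simp add: card_image[OF inj] card_cartesian_product)
  have QI: "Q \<subseteq> [verts n]\<^bsup>2\<^esup>" using assms(3-5) by (auto simp: Q_def simp del: atLeastAtMost_iff)
  have count: "(\<Sum>v\<in>A. real (card (nbrs S v B))) = real (card (S \<inter> Q))" for S
  proof -
    have "S \<inter> Q = (\<lambda>(a, b). {a, b}) ` (SIGMA v:A. nbrs S v B)"
      by (auto simp: Q_def nbrs_def)
    moreover have "inj_on (\<lambda>(a, b). {a, b}) (SIGMA v:A. nbrs S v B)"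
      by (rule inj_on_subset[OF inj]) (auto simp: nbrs_def)
    ultimately have "card (S \<inter> Q) = card (SIGMA v:A. nbrs S v B)" by (simp add: card_image)
    also have "\<dots> = (\<Sum>v\<in>A. card (nbrs S v B))" using fin by (intro card_SigmaI) (auto simp: nbrs_def)
    finally show ?thesis by simp
  qed
  show ?thesis
    using edge_count_tail[OF finite_imp_finite_nsets[OF finite_atLeastAtMost] QI assms(1,2), of y]
    by (simp add: count cardQ mult.assoc)
qed

text \<open>
  Reveal the edges at \<open>u\<close> first. Given these, the codegree of \<open>u\<close> and \<open>v\<close> counts those edges from \<open>v\<close> to the
  neighbours of \<open>u\<close> that are present. So its exponential moment is a power of \<open>1 + 2 p\<close> whose exponent is the
  degree of \<open>u\<close>, and the mean of that power is again an exponential moment.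
\<close>

lemma codegree_tail:
  assumes "0 \<le> p" "p \<le> 1" "u \<in> verts n" "v \<in> verts n" "u \<noteq> v"
  shows "subset_mean p ([verts n]\<^bsup>2\<^esup>)
    (\<lambda>S. of_bool (4 * real n * p\<^sup>2 + y < real (card (nbrs S u (verts n) \<inter> nbrs S v (verts n))))) \<le> exp (- y)"
proof (rule exp_moment_bound)
  let ?I = "[verts n]\<^bsup>2\<^esup>"
  define B where "B = verts n - {u, v}"
  define St where "St = (\<lambda>w. {u, w}) ` B"
  define f where "f S = card (nbrs S u (verts n) \<inter> nbrs S v (verts n))" for S
  have finI: "finite ?I" by (simp add: finite_imp_finite_nsets)
  have finB: "finite B" by (simp add: B_def)
  have StI: "St \<subseteq> ?I" using assms by (auto simp: St_def B_def)
  have I: "?I = St \<union> (?I - St)" using StI by auto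
  have injw: "inj (\<lambda>w. {x, w})" for x :: nat by (auto simp: inj_on_def doubleton_eq_iff)
  have inner: "subset_mean p (?I - St) (\<lambda>T. exp 1 ^ f (S \<union> T)) \<le> (1 + 2 * p) ^ card (S \<inter> St)"
    if S: "S \<subseteq> St" for S
  proof -
    define C where "C = {w \<in> B. {u, w} \<in> S}"
    define Q where "Q = (\<lambda>w. {v, w}) ` C"
    have cQ: "card Q = card C" unfolding Q_def by (rule card_image) (rule inj_on_subset[OF injw], simp)
    have "S = (\<lambda>w. {u, w}) ` C" using S by (auto simp: C_def St_def)
    then have cS: "card S = card C" using card_image[OF inj_on_subset[OF injw[of u], of C]] by simp
    have QJ: "Q \<subseteq> ?I - St"
      using assms by (auto simp: Q_def C_def B_def St_def doubleton_eq_iff)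
    have fT: "f (S \<union> T) = card (T \<inter> Q)" if T: "T \<subseteq> ?I - St" for T
    proof -
      have "nbrs (S \<union> T) u (verts n) \<inter> nbrs (S \<union> T) v (verts n) = {w \<in> C. {v, w} \<in> T}" (is "?L = ?R")
      proof (intro set_eqI iffI)
        fix w assume "w \<in> ?L"
        then have w: "w \<in> verts n" "{u, w} \<in> S \<union> T" "{v, w} \<in> S \<union> T" by (auto simp: nbrs_def)
        have "S \<union> T \<subseteq> ?I" using S T StI by auto
        then have "w \<noteq> u" "w \<noteq> v" using w by (auto simp: nsets_def)
        then have wB: "w \<in> B" using w by (simp add: B_def)
        then have "{u, w} \<in> St" by (simp add: St_def)
        then have "{u, w} \<in> S" using w T by auto
        moreover have "{v, w} \<notin> St"
          using assms(5) \<open>w \<noteq> u\<close> by (auto simp: St_def doubleton_eq_iff)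
        ultimately show "w \<in> ?R" using w S wB by (auto simp: C_def)
      next
        fix w assume "w \<in> ?R"
        then show "w \<in> ?L" by (auto simp: nbrs_def C_def B_def)
      qed
      moreover have "T \<inter> Q = (\<lambda>w. {v, w}) ` {w \<in> C. {v, w} \<in> T}" by (auto simp: Q_def)
      then have "card (T \<inter> Q) = card {w \<in> C. {v, w} \<in> T}"
        using card_image[OF inj_on_subset[OF injw[of v]]] by simp
      ultimately show ?thesis by (simp add: f_def)
    qed
    have "subset_mean p (?I - St) (\<lambda>T. exp 1 ^ f (S \<union> T)) = subset_mean p (?I - St) (\<lambda>T. exp 1 ^ card (T \<inter> Q))"
      by (intro subset_mean_cong) (simp add: fT)
    also have "\<dots> = (1 - p + p * exp 1) ^ card C"
      using subset_mean_mgf[OF _ QJ] finI cQ by simp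
    also have "\<dots> \<le> (1 + 2 * p) ^ card C"
    proof (intro power_mono)
      have "p * exp 1 \<le> p * 3" using exp_le assms by (intro mult_left_mono) auto
      then show "1 - p + p * exp 1 \<le> 1 + 2 * p" by simp
      show "0 \<le> 1 - p + p * exp 1" using assms by simp
    qed
    also have "card C = card (S \<inter> St)" using S cS by (simp add: Int_absorb2)
    finally show ?thesis .
  qed
  have "subset_mean p ?I (\<lambda>S. exp 1 ^ f S) = subset_mean p St (\<lambda>S. subset_mean p (?I - St) (\<lambda>T. exp 1 ^ f (S \<union> T)))"
    by (subst I, rule subset_mean_union) (use finI StI in \<open>auto intro: finite_subset\<close>)
  also have "\<dots> \<le> subset_mean p St (\<lambda>S. (1 + 2 * p) ^ card (S \<inter> St))"
    by (intro subset_mean_mono assms inner)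
  also have "\<dots> = (1 - p + p * (1 + 2 * p)) ^ card St"
    using finB by (intro subset_mean_mgf) (auto simp: St_def)
  also have "\<dots> \<le> exp (p * (1 + 2 * p - 1) * real (card St))"
    using assms by (intro mgf_le_exp) auto
  also have "\<dots> \<le> exp (4 * real n * p\<^sup>2)"
  proof -
    have "card St \<le> card B" unfolding St_def using finB by (rule card_image_le)
    also have "\<dots> \<le> card (verts n)" by (intro card_mono) (auto simp: B_def)
    finally have "2 * p\<^sup>2 * real (card St) \<le> 4 * p\<^sup>2 * real n"
      using assms by (intro mult_mono) auto
    then show ?thesis by (simp add: power2_eq_square mult_ac)
  qed
  finally show "subset_mean p ?I (\<lambda>S. exp 1 ^ card (nbrs S u (verts n) \<inter> nbrs S v (verts n)))
      \<le> exp (4 * real n * p\<^sup>2)" by (simp add: f_def)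
qed (use assms in \<open>auto intro: finite_imp_finite_nsets\<close>)

lemma sum_Pow_power_card:
  fixes x :: real
  assumes "finite V"
  shows "(\<Sum>A\<in>Pow V. x ^ card A) = (1 + x) ^ card V"
  using assms
proof (induction V rule: finite_induct)
  case (insert v V)
  have inj: "inj_on (insert v) (Pow V)" using insert.hyps by (auto simp: inj_on_def)
  have "(\<Sum>A\<in>Pow (insert v V). x ^ card A) = (\<Sum>A\<in>Pow V. x ^ card A) + (\<Sum>A\<in>insert v ` Pow V. x ^ card A)"
    unfolding Pow_insert using insert.hyps by (intro sum.union_disjoint) auto
  also have "(\<Sum>A\<in>insert v ` Pow V. x ^ card A) = (\<Sum>A\<in>Pow V. x * x ^ card A)"
    unfolding sum.reindex[OF inj] comp_def
  proof (rule sum.cong)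
    fix A assume "A \<in> Pow V"
    then have "v \<notin> A" "finite A" using insert.hyps by (auto intro: finite_subset)
    then show "x ^ card (insert v A) = x * x ^ card A" by simp
  qed simp
  finally show ?case using insert by (simp add: sum_distrib_left[symmetric] algebra_simps)
qed simp

section \<open>A clique in every set\<close>

text \<open>
  The two pseudorandom properties of the graph that the counting of uncovered triples needs: small
  codegrees, and no pair of disjoint sets with far too many edges in between.
\<close>

definition typical :: "nat \<Rightarrow> real \<Rightarrow> nat set set \<Rightarrow> bool" where
  "typical n p E \<longleftrightarrow>
     (\<forall>u\<in>verts n. \<forall>v\<in>verts n. u \<noteq> v \<longrightarrow>
        real (card (nbrs E u (verts n) \<inter> nbrs E v (verts n))) \<le> 4 * real n * p\<^sup>2 + 3 * ln (real n)) \<and>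
     (\<forall>A\<subseteq>verts n. \<forall>B\<subseteq>verts n. A \<inter> B = {} \<longrightarrow>
        (\<Sum>v\<in>A. real (card (nbrs E v B))) \<le>
          2 * p * real (card A) * real (card B) + 4 * (real (card A) + real (card B) + 1) * ln (real n))"

text \<open>
  The numerical conditions on \<open>l\<close>, the lower bound for the number of non-neighbours. The lower
  bounds for \<open>p l\<close> and \<open>l\<^sup>2 p\<^sup>3\<close> make \<open>l w p\<close> and \<open>l w\<^sup>2 p\<^sup>3\<close> large multiples of \<open>w log n\<close> if \<open>w \<ge> l\<close>, which
  pays for the union bound over \<open>W\<close>; the other conditions are needed to count uncovered triples.
\<close>

definition admissible :: "nat \<Rightarrow> real \<Rightarrow> real \<Rightarrow> bool" where
  "admissible n p l \<longleftrightarrow> 0 < p \<and> 1000 \<le> ln (real n) \<and> 62208 * ln (real n) \<le> p * l \<and>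
     1728 * ln (real n) \<le> l\<^sup>2 * p ^ 3 \<and> 4 * p * ln (real n) < 1 \<and> 2000 * real n * p ^ 3 \<le> 1 \<and>
     20000 * ln (real n) ^ 4 * (4 * real n * p\<^sup>2 + 3 * ln (real n)) \<le> l"

text \<open>
  Reveal the edges not inside \<open>W\<close> first. They determine the neighbourhoods in \<open>W\<close> of the outside vertices,
  hence the family of uncovered triples. If some outcome inside \<open>W\<close> makes the graph typical, this
  family is large; the edges inside \<open>W\<close> are independent of it and must avoid all its triangles.
\<close>

lemma unhit_set_bound:
  assumes adm: "admissible n p l" and W: "W \<subseteq> verts n" "verts n - W \<noteq> {}"
  shows "subset_mean p ([verts n]\<^bsup>2\<^esup>) (\<lambda>E. of_bool (typical n p E \<and>
      (\<forall>v\<in>verts n - W. l \<le> real (card (W - nbrs E v W))) \<and>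
      (\<forall>t\<in>[W]\<^bsup>3\<^esup>. (\<forall>v\<in>verts n - W. \<not> t \<subseteq> nbrs E v W) \<longrightarrow> \<not> [t]\<^bsup>2\<^esup> \<subseteq> E)))
    \<le> exp (- (4 * (real (card W) + 1) * ln (real n)))" (is "subset_mean p ?I (\<lambda>E. of_bool (?bad E)) \<le> ?r")
proof -
  define X \<Lambda> where "X = verts n - W" and "\<Lambda> = ln (real n)"
  have fin: "finite W" "finite X" "finite ?I" "finite ([W]\<^bsup>2\<^esup>)"
    using W finite_subset[OF W(1)] by (auto simp: X_def finite_imp_finite_nsets)
  have par: "0 < p" "1000 \<le> \<Lambda>" "62208 * \<Lambda> \<le> p * l" "1728 * \<Lambda> \<le> l\<^sup>2 * p ^ 3" "4 * p * \<Lambda> < 1"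
    "2000 * real n * p ^ 3 \<le> 1" "20000 * \<Lambda> ^ 4 * (4 * real n * p\<^sup>2 + 3 * \<Lambda>) \<le> l"
    using adm by (auto simp: admissible_def \<Lambda>_def)
  have p1: "p < 1 / 4000"
  proof -
    have "p * 4000 \<le> p * (4 * \<Lambda>)" using par(1,2) by (intro mult_left_mono) auto
    also have "\<dots> = 4 * p * \<Lambda>" by simp
    finally show ?thesis using par(5) by linarith
  qed
  have p2: "12 * p\<^sup>2 \<le> 1"
  proof -
    have "p * p \<le> (1 / 4000) * (1 / 4000)" using p1 par(1) by (intro mult_mono) auto
    then show ?thesis by (simp add: power2_eq_square)
  qed
  have l0: "0 < l"
  proof (rule ccontr)
    assume "\<not> 0 < l"
    then have "p * l \<le> 0" using par(1) by (simp add: mult_nonneg_nonpos)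
    then show False using par(2,3) by simp
  qed
  have cross: "nbrs (S \<union> T) v W = nbrs S v W" if "T \<subseteq> [W]\<^bsup>2\<^esup>" "v \<in> X" for S T v
    using that by (auto simp: nbrs_def X_def nsets_def)
  have bound: "subset_mean p ([W]\<^bsup>2\<^esup>) (\<lambda>T. of_bool (?bad (S \<union> T))) \<le> ?r" for S
  \<comment> \<open>typicality also involves the edges inside \<open>W\<close>, but one witness \<open>T0\<close> suffices to count uncovered triples\<close>
  proof (cases "\<exists>T0\<subseteq>[W]\<^bsup>2\<^esup>. ?bad (S \<union> T0)")
    case False
    then have "subset_mean p ([W]\<^bsup>2\<^esup>) (\<lambda>T. of_bool (?bad (S \<union> T))) = subset_mean p ([W]\<^bsup>2\<^esup>) (\<lambda>T. 0)"
      by (intro subset_mean_cong) auto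
    then show ?thesis using fin by (simp add: subset_mean_const)
  next
    case True
    then obtain T0 where T0: "T0 \<subseteq> [W]\<^bsup>2\<^esup>" and bad: "?bad (S \<union> T0)" by blast
    define N where "N v = nbrs S v W" for v
    have N: "nbrs (S \<union> T) v W = N v" if "T \<subseteq> [W]\<^bsup>2\<^esup>" "v \<in> X" for T v
      using cross[OF that] by (simp add: N_def)
    have nonnb: "l \<le> real (card (W - N v))" if "v \<in> X" for v
      unfolding N[OF T0 that, symmetric] using bad that unfolding X_def by blast
    define Tr where "Tr = {t \<in> [W]\<^bsup>3\<^esup>. \<forall>v\<in>X. \<not> t \<subseteq> N v}"
    have many: "l * (real (card W))\<^sup>2 \<le> 54 * real (card Tr)"
      unfolding Tr_def
    proof (rule many_uncovered_triples[where \<Lambda> = \<Lambda> and p = p and c = "4 * real n * p\<^sup>2 + 3 * \<Lambda>"])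
      show "finite X" "finite W" "X \<noteq> {}" using fin W(2) by (auto simp: X_def)
      show "N v \<subseteq> W" for v by (auto simp: N_def nbrs_def)
      show "l \<le> real (card (W - N v))" if "v \<in> X" for v
        using that by (rule nonnb)
      show "0 < p" "1000 \<le> \<Lambda>" "4 * p * \<Lambda> < 1"
        "20000 * \<Lambda> ^ 4 * (4 * real n * p\<^sup>2 + 3 * \<Lambda>) \<le> l" by (fact par)+
      show "4 * \<Lambda> \<le> p * l" using par(2,3) by simp
      show "0 \<le> 4 * real n * p\<^sup>2 + 3 * \<Lambda>" using par(2) by simp
      have "card X \<le> card (verts n)" by (intro card_mono) (auto simp: X_def)
      then have "2000 * real (card X) * p ^ 3 \<le> 2000 * real n * p ^ 3"
        using par(1) by (intro mult_right_mono) auto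
      then show "2000 * real (card X) * p ^ 3 \<le> 1" using par(6) by simp
      have isT: "typical n p (S \<union> T0)" using bad by blast
      show "real (card (N u \<inter> N v)) \<le> 4 * real n * p\<^sup>2 + 3 * \<Lambda>"
        if uv: "u \<in> X" "v \<in> X" "u \<noteq> v" for u v
      proof -
        have "N u \<inter> N v \<subseteq> nbrs (S \<union> T0) u (verts n) \<inter> nbrs (S \<union> T0) v (verts n)"
          using W(1) by (auto simp: N_def nbrs_def)
        then have "card (N u \<inter> N v) \<le> card (nbrs (S \<union> T0) u (verts n) \<inter> nbrs (S \<union> T0) v (verts n))"
          by (intro card_mono) (auto simp: nbrs_def)
        moreover have "real (card (nbrs (S \<union> T0) u (verts n) \<inter> nbrs (S \<union> T0) v (verts n)))
            \<le> 4 * real n * p\<^sup>2 + 3 * \<Lambda>"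
          using isT uv unfolding typical_def X_def \<Lambda>_def by blast
        ultimately show ?thesis by linarith
      qed
      show "(\<Sum>v\<in>A. real (card (N v \<inter> B))) \<le> 2 * p * real (card A) * real (card B)
          + 4 * (real (card A) + real (card B) + 1) * \<Lambda>" if AB: "A \<subseteq> X" "B \<subseteq> W" for A B
      proof -
        have "N v \<inter> B = nbrs (S \<union> T0) v B" if "v \<in> A" for v
        proof -
          have "N v \<inter> B = nbrs (S \<union> T0) v W \<inter> B" using N[OF T0] that AB by auto
          then show ?thesis using AB by (auto simp: nbrs_def)
        qed
        moreover have "A \<subseteq> verts n" "B \<subseteq> verts n" "A \<inter> B = {}" using AB W by (auto simp: X_def)
        ultimately show ?thesis using isT by (simp add: typical_def \<Lambda>_def)
      qed
    qed
    let ?w = "real (card W)"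
    have "Tr \<noteq> {}"
    proof
      assume "Tr = {}"
      then have "l * ?w\<^sup>2 \<le> 0" using many by simp
      then have "?w = 0" using l0 by (simp add: mult_le_0_iff)
      moreover obtain v where "v \<in> X" using W(2) unfolding X_def by blast
      then have "l \<le> real (card (W - N v))" by (rule nonnb)
      ultimately show False using l0 fin by auto
    qed
    obtain v where v: "v \<in> X" using W(2) unfolding X_def by blast
    have lw: "l \<le> ?w"
    proof -
      have "l \<le> real (card (W - N v))" using v by (rule nonnb)
      also have "\<dots> \<le> ?w" using fin by (intro of_nat_mono card_mono) auto
      finally show ?thesis .
    qed
    have "0 < ?w" using lw l0 by simp
    then have w1: "1 \<le> ?w" by simp
    have "subset_mean p ([W]\<^bsup>2\<^esup>) (\<lambda>T. of_bool (?bad (S \<union> T)))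
        \<le> subset_mean p ([W]\<^bsup>2\<^esup>) (\<lambda>T. of_bool (\<forall>t\<in>Tr. \<not> [t]\<^bsup>2\<^esup> \<subseteq> T))"
    proof (rule subset_mean_mono)
      fix T assume T: "T \<subseteq> [W]\<^bsup>2\<^esup>"
      have "\<not> [t]\<^bsup>2\<^esup> \<subseteq> T" if b: "?bad (S \<union> T)" and t: "t \<in> Tr" for t
      proof -
        have "\<forall>v\<in>verts n - W. \<not> t \<subseteq> nbrs (S \<union> T) v W"
          using t N[OF T] by (auto simp: Tr_def X_def)
        moreover have "t \<in> [W]\<^bsup>3\<^esup>" using t by (simp add: Tr_def)
        ultimately have "\<not> [t]\<^bsup>2\<^esup> \<subseteq> S \<union> T" using b by blast
        then show ?thesis by blast
      qed
      then show "of_bool (?bad (S \<union> T)) \<le> (of_bool (\<forall>t\<in>Tr. \<not> [t]\<^bsup>2\<^esup> \<subseteq> T) :: real)"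
        unfolding of_bool_def by auto
    qed (use par(1) p1 in auto)
    also have "\<dots> \<le> exp (- (real (card Tr) * p ^ 3 / (2 * (1 + 36 * ?w * p\<^sup>2))))"
      using fin par(1) p2 by (intro triangle_avoidance_bound) (auto simp: Tr_def)
    also have "\<dots> \<le> ?r"
    proof -
      \<comment> \<open>the two terms on the right are at most half of \<open>l * ?w\<^sup>2 * p ^ 3\<close> each; this fixes the constants
        \<open>1728 = 2 * 864\<close> and \<open>62208 = 2 * 31104\<close> in \<open>admissible\<close>\<close>
      have "8 * ?w * \<Lambda> * (2 * (1 + 36 * ?w * p\<^sup>2)) * 54 = 864 * ?w * \<Lambda> + 31104 * ?w\<^sup>2 * p\<^sup>2 * \<Lambda>"
        by (simp add: algebra_simps power2_eq_square)
      also have "\<dots> \<le> l * ?w\<^sup>2 * p ^ 3"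
      proof -
        have "(1728 * \<Lambda>) * ?w \<le> (l * (l * p ^ 3)) * ?w"
          using par(4) by (intro mult_right_mono) (auto simp: power2_eq_square mult_ac)
        also have "\<dots> \<le> (?w * (l * p ^ 3)) * ?w"
          using lw l0 par(1) by (intro mult_right_mono) auto
        finally have a: "1728 * (?w * \<Lambda>) \<le> l * ?w\<^sup>2 * p ^ 3"
          by (simp add: power2_eq_square mult_ac)
        have "(62208 * \<Lambda>) * (?w\<^sup>2 * p\<^sup>2) \<le> (p * l) * (?w\<^sup>2 * p\<^sup>2)"
          using par(3) by (intro mult_right_mono) auto
        then have b: "62208 * (?w\<^sup>2 * p\<^sup>2 * \<Lambda>) \<le> l * ?w\<^sup>2 * p ^ 3"
          by (simp add: power2_eq_square power3_eq_cube mult_ac)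
        show ?thesis using a b by simp
      qed
      also have "\<dots> \<le> 54 * real (card Tr) * p ^ 3"
        using many par(1) by (intro mult_right_mono) auto
      finally have key: "8 * ?w * \<Lambda> * (2 * (1 + 36 * ?w * p\<^sup>2)) \<le> real (card Tr) * p ^ 3"
        by (simp add: algebra_simps)
      have pos: "0 < 2 * (1 + 36 * ?w * p\<^sup>2)" by (intro mult_pos_pos add_pos_nonneg) auto
      have "8 * ?w * \<Lambda> \<le> real (card Tr) * p ^ 3 / (2 * (1 + 36 * ?w * p\<^sup>2))"
        by (rule iffD2[OF pos_le_divide_eq[OF pos] key])
      moreover have "4 * (?w + 1) * \<Lambda> \<le> 8 * ?w * \<Lambda>"
        using w1 par(2) by (intro mult_right_mono) auto
      ultimately have "4 * (?w + 1) * \<Lambda> \<le> real (card Tr) * p ^ 3 / (2 * (1 + 36 * ?w * p\<^sup>2))"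
        by (rule order.trans[rotated])
      then show ?thesis unfolding \<Lambda>_def by (simp only: exp_le_cancel_iff neg_le_iff_le)
    qed
    finally show ?thesis .
  qed
  have I: "?I = (?I - [W]\<^bsup>2\<^esup>) \<union> [W]\<^bsup>2\<^esup>"
    using nsets_mono[OF W(1), of 2] by auto
  have "subset_mean p ?I (\<lambda>E. of_bool (?bad E)) =
      subset_mean p (?I - [W]\<^bsup>2\<^esup>) (\<lambda>S. subset_mean p ([W]\<^bsup>2\<^esup>) (\<lambda>T. of_bool (?bad (S \<union> T))))"
    by (subst I, rule subset_mean_union) (use fin in auto)
  also have "\<dots> \<le> subset_mean p (?I - [W]\<^bsup>2\<^esup>) (\<lambda>S. ?r)"
    using par(1) p1 bound by (intro subset_mean_mono) auto
  also have "\<dots> = ?r" using fin by (intro subset_mean_const) auto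
  finally show ?thesis .
qed

lemma of_bool_ex_le_sum:
  assumes "finite A"
  shows "of_bool (\<exists>q\<in>A. P q) \<le> (\<Sum>q\<in>A. of_bool (P q) :: real)"
proof (cases "\<exists>q\<in>A. P q")
  case True
  then obtain q where "q \<in> A" "P q" by blast
  then have "(of_bool (P q) :: real) \<le> (\<Sum>q\<in>A. of_bool (P q))"
    using assms by (intro member_le_sum) auto
  then show ?thesis using \<open>P q\<close> True by simp
qed (simp add: sum_nonneg)

text \<open>
  A union bound over three kinds of failure: a pair of vertices with large codegree, a pair of disjoint
  sets with too many edges in between, and a set \<open>W\<close> as in \<open>unhit_set_bound\<close>. The number \<open>x\<close> is \<open>n\<close> to
  the power \<open>- 4\<close>, and sums over all vertex sets \<open>A\<close> of \<open>x\<close> to the power \<open>|A|\<close> are \<open>(1 + x)\<close> to the power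
  \<open>n\<close>, which is bounded.
\<close>

lemma hitting_clique_prob:
  assumes adm: "admissible n p l"
  shows "1 - 13 / real n \<le> measure_pmf.prob (Gnp n p)
    {E. \<forall>W\<subseteq>verts n. verts n - W \<noteq> {} \<longrightarrow> (\<forall>v\<in>verts n - W. l \<le> real (card (nonneighbors E v W))) \<longrightarrow>
       (\<exists>K\<subseteq>W. clique K E \<and> (\<forall>v\<in>verts n - W. nonneighbors E v K \<noteq> {}))}"
    (is "_ \<le> measure_pmf.prob _ ?G")
proof -
  let ?V = "verts n" and ?I = "[verts n]\<^bsup>2\<^esup>"
  define \<Lambda> where "\<Lambda> = ln (real n)"
  define x where "x = exp (- 4 * \<Lambda>)"
  have par: "0 < p" "1000 \<le> \<Lambda>" "4 * p * \<Lambda> < 1" using adm by (auto simp: admissible_def \<Lambda>_def)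
  have p1: "p \<le> 1"
  proof -
    have "p * 1 \<le> p * (4 * \<Lambda>)" using par(1,2) by (intro mult_left_mono) auto
    then show ?thesis using par(3) by (simp add: mult_ac)
  qed
  have n0: "0 < real n" using par(2) unfolding \<Lambda>_def by (cases "n = 0") auto
  then have expL: "exp \<Lambda> = real n" by (simp add: \<Lambda>_def)
  have finI: "finite ?I" by (simp add: finite_imp_finite_nsets)
  define bad where "bad W E \<longleftrightarrow> ?V - W \<noteq> {} \<and> typical n p E \<and>
      (\<forall>v\<in>?V - W. l \<le> real (card (W - nbrs E v W))) \<and>
      (\<forall>t\<in>[W]\<^bsup>3\<^esup>. (\<forall>v\<in>?V - W. \<not> t \<subseteq> nbrs E v W) \<longrightarrow> \<not> [t]\<^bsup>2\<^esup> \<subseteq> E)" for W E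
  define cd where "cd = (\<lambda>(u, v) E. u \<noteq> v \<and>
    4 * real n * p\<^sup>2 + 3 * \<Lambda> < real (card (nbrs E u ?V \<inter> nbrs E v ?V)))"
  define ed where "ed = (\<lambda>(A, B) E. A \<inter> B = {} \<and>
    2 * p * real (card A) * real (card B) + 4 * (real (card A) + real (card B) + 1) * \<Lambda>
      < (\<Sum>v\<in>A. real (card (nbrs E v B))))"
  have cases: "E \<in> ?G \<or> (\<exists>q\<in>?V \<times> ?V. cd q E) \<or> (\<exists>q\<in>Pow ?V \<times> Pow ?V. ed q E) \<or> (\<exists>W\<in>Pow ?V. bad W E)" for E
  proof (cases "typical n p E")
    case False
    then consider u v where "u \<in> ?V" "v \<in> ?V" "cd (u, v) E"
      | A B where "A \<subseteq> ?V" "B \<subseteq> ?V" "ed (A, B) E"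
      unfolding typical_def cd_def ed_def \<Lambda>_def prod.case not_le[symmetric] by blast
    then show ?thesis by cases blast+
  next
    case isT: True
    show ?thesis
    proof (cases "\<exists>W\<in>Pow ?V. bad W E")
      case False
      have "E \<in> ?G"
      proof (intro CollectI allI impI)
        fix W assume W: "W \<subseteq> ?V" "?V - W \<noteq> {}"
          "\<forall>v\<in>?V - W. l \<le> real (card (nonneighbors E v W))"
        have nn: "nonneighbors E v W = W - nbrs E v W" if "v \<in> ?V - W" for v
          using that by (auto simp: nonneighbors_def nbrs_def)
        have "\<not> bad W E" using False W by blast
        then obtain t where t: "t \<in> [W]\<^bsup>3\<^esup>" "\<forall>v\<in>?V - W. \<not> t \<subseteq> nbrs E v W" "[t]\<^bsup>2\<^esup> \<subseteq> E"
          using W isT nn by (auto simp: bad_def)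
        have tW: "t \<subseteq> W" using t by (simp add: nsets_def)
        have "clique t E"
          unfolding clique_def
        proof (intro ballI impI)
          fix v w assume "v \<in> t" "w \<in> t" "v \<noteq> w"
          then have "{v, w} \<in> [t]\<^bsup>2\<^esup>" by simp
          then show "{v, w} \<in> E" using t(3) by blast
        qed
        moreover have "nonneighbors E v t \<noteq> {}" if "v \<in> ?V - W" for v
        proof -
          have "\<not> t \<subseteq> nbrs E v W" using t(2) that by (rule bspec)
          then obtain w where w: "w \<in> t" "w \<notin> nbrs E v W" unfolding subset_iff by metis
          have "w \<in> W" using w(1) tW by (rule subsetD[rotated])
          then have "w \<in> nonneighbors E v t"
            using w that by (simp add: nonneighbors_def nbrs_def) metis
          then show ?thesis by blast
        qed
        ultimately show "\<exists>K\<subseteq>W. clique K E \<and> (\<forall>v\<in>?V - W. nonneighbors E v K \<noteq> {})" using tW by blast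
      qed
      then show ?thesis by blast
    qed blast
  qed
  have "1 - measure_pmf.prob (Gnp n p) ?G = subset_mean p ?I (\<lambda>E. 1 - of_bool (E \<in> ?G))"
    using par(1) p1 finI
    by (subst Gnp_prob_eq_subset_mean) (simp_all only: subset_mean_diff subset_mean_const less_imp_le)
  also have "\<dots> \<le> subset_mean p ?I (\<lambda>E. (\<Sum>q\<in>?V \<times> ?V. of_bool (cd q E)) +
      ((\<Sum>q\<in>Pow ?V \<times> Pow ?V. of_bool (ed q E)) + (\<Sum>W\<in>Pow ?V. of_bool (bad W E))))"
  proof (rule subset_mean_mono)
    fix E
    have "1 - of_bool (E \<in> ?G) \<le> of_bool (\<exists>q\<in>?V \<times> ?V. cd q E) +
        (of_bool (\<exists>q\<in>Pow ?V \<times> Pow ?V. ed q E) + (of_bool (\<exists>W\<in>Pow ?V. bad W E) :: real))"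
      using cases[of E] by (elim disjE) (simp_all only: of_bool_eq, simp_all)
    also have "\<dots> \<le> (\<Sum>q\<in>?V \<times> ?V. of_bool (cd q E)) +
      ((\<Sum>q\<in>Pow ?V \<times> Pow ?V. of_bool (ed q E)) + (\<Sum>W\<in>Pow ?V. of_bool (bad W E)))"
      by (intro add_mono of_bool_ex_le_sum) auto
    finally show "1 - (of_bool (E \<in> ?G) :: real) \<le> (\<Sum>q\<in>?V \<times> ?V. of_bool (cd q E)) +
      ((\<Sum>q\<in>Pow ?V \<times> Pow ?V. of_bool (ed q E)) + (\<Sum>W\<in>Pow ?V. of_bool (bad W E)))" .
  qed (use par(1) p1 in auto)
  also have "\<dots> = (\<Sum>q\<in>?V \<times> ?V. subset_mean p ?I (\<lambda>E. of_bool (cd q E))) +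
      ((\<Sum>q\<in>Pow ?V \<times> Pow ?V. subset_mean p ?I (\<lambda>E. of_bool (ed q E)))
       + (\<Sum>W\<in>Pow ?V. subset_mean p ?I (\<lambda>E. of_bool (bad W E))))"
    by (simp only: subset_mean_add subset_mean_sum)
  also have "\<dots> \<le> 1 / real n + (9 * x + 3 * x)"
  proof (intro add_mono)
    have "(\<Sum>q\<in>?V \<times> ?V. subset_mean p ?I (\<lambda>E. of_bool (cd q E))) \<le> (\<Sum>q\<in>?V \<times> ?V. exp (- (3 * \<Lambda>)))"
    proof (rule sum_mono)
      fix q assume "q \<in> ?V \<times> ?V"
      then obtain u v where q: "q = (u, v)" "u \<in> ?V" "v \<in> ?V" by auto
      show "subset_mean p ?I (\<lambda>E. of_bool (cd q E)) \<le> exp (- (3 * \<Lambda>))"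
      proof (cases "u = v")
        case True
        then show ?thesis using q finI by (simp add: cd_def subset_mean_const)
      next
        case False
        then show ?thesis using codegree_tail[of p u n v "3 * \<Lambda>"] par(1) p1 q
          by (simp add: cd_def)
      qed
    qed
    also have "\<dots> = (real n)\<^sup>2 * exp (- (3 * \<Lambda>))" by (simp add: card_cartesian_product power2_eq_square)
    also have "exp (- (3 * \<Lambda>)) = 1 / real n ^ 3"
      using exp_of_nat_mult[of 3 \<Lambda>] by (simp add: exp_minus expL inverse_eq_divide)
    also have "(real n)\<^sup>2 * (1 / real n ^ 3) = 1 / real n"
      using n0 by (simp add: power2_eq_square power3_eq_cube)
    finally show "(\<Sum>q\<in>?V \<times> ?V. subset_mean p ?I (\<lambda>E. of_bool (cd q E))) \<le> 1 / real n" .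
    have xe: "exp (- (4 * (real a + real b + 1) * \<Lambda>)) = x * (x ^ a * x ^ b)" for a b
      unfolding x_def by (simp flip: exp_of_nat_mult exp_add add: algebra_simps)
    have xp: "x = 1 / real n ^ 4"
      using exp_of_nat_mult[of 4 \<Lambda>] by (simp add: x_def exp_minus expL inverse_eq_divide)
    have s3: "(\<Sum>A\<in>Pow ?V. x ^ card A) \<le> 3"
    proof -
      have x0: "0 \<le> x" by (simp add: x_def)
      have "(\<Sum>A\<in>Pow ?V. x ^ card A) = (1 + x) ^ n" by (simp add: sum_Pow_power_card)
      also have "\<dots> \<le> exp x ^ n" using exp_ge_add_one_self[of x] x0 by (intro power_mono) auto
      also have "\<dots> = exp (real n * x)" by (simp add: exp_of_nat_mult)
      also have "\<dots> \<le> exp 1"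
      proof -
        have "1 \<le> real n ^ 3" using n0 by (intro one_le_power) simp
        then have "real n * x \<le> 1" using n0 by (simp add: xp eval_nat_numeral field_simps)
        then show ?thesis by simp
      qed
      also have "\<dots> \<le> 3" by (rule exp_le)
      finally show ?thesis .
    qed
    have s0: "0 \<le> (\<Sum>A\<in>Pow ?V. x ^ card A)" and x0: "0 \<le> x" by (auto intro: sum_nonneg simp: x_def)
    have "(\<Sum>q\<in>Pow ?V \<times> Pow ?V. subset_mean p ?I (\<lambda>E. of_bool (ed q E)))
        \<le> (\<Sum>q\<in>Pow ?V \<times> Pow ?V. x * (x ^ card (fst q) * x ^ card (snd q)))"
    proof (rule sum_mono)
      fix q assume "q \<in> Pow ?V \<times> Pow ?V"
      then obtain A B where q: "q = (A, B)" "A \<subseteq> ?V" "B \<subseteq> ?V" by auto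
      show "subset_mean p ?I (\<lambda>E. of_bool (ed q E)) \<le> x * (x ^ card (fst q) * x ^ card (snd q))"
      proof (cases "A \<inter> B = {}")
        case False
        then show ?thesis using q finI x0 by (simp add: ed_def subset_mean_const)
      next
        case True
        then show ?thesis
          using edges_between_tail[of p A n B "4 * (real (card A) + real (card B) + 1) * \<Lambda>"] par(1) p1 q(2,3)
          unfolding q(1) ed_def prod.case fst_conv snd_conv xe[symmetric] by simp
      qed
    qed
    also have "\<dots> = (\<Sum>A\<in>Pow ?V. \<Sum>B\<in>Pow ?V. x * (x ^ card A * x ^ card B))"
      by (simp add: sum.cartesian_product case_prod_beta)
    also have "\<dots> = x * ((\<Sum>A\<in>Pow ?V. x ^ card A) * (\<Sum>B\<in>Pow ?V. x ^ card B))"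
      unfolding sum_product unfolding sum_distrib_left ..
    also have "\<dots> \<le> x * (3 * 3)" using s3 s0 x0 by (intro mult_left_mono mult_mono) auto
    finally show "(\<Sum>q\<in>Pow ?V \<times> Pow ?V. subset_mean p ?I (\<lambda>E. of_bool (ed q E))) \<le> 9 * x" by simp
    have "(\<Sum>W\<in>Pow ?V. subset_mean p ?I (\<lambda>E. of_bool (bad W E))) \<le> (\<Sum>W\<in>Pow ?V. x * x ^ card W)"
    proof (rule sum_mono)
      fix W assume W: "W \<in> Pow ?V"
      show "subset_mean p ?I (\<lambda>E. of_bool (bad W E)) \<le> x * x ^ card W"
      proof (cases "?V - W = {}")
        case True
        then show ?thesis using finI x0 by (simp add: bad_def subset_mean_const)
      next
        case False
        have "subset_mean p ?I (\<lambda>E. of_bool (bad W E)) \<le> exp (- (4 * (real (card W) + 1) * \<Lambda>))"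
          using unhit_set_bound[OF adm _ False] W unfolding bad_def \<Lambda>_def using False by simp
        also have "\<dots> = x * x ^ card W" using xe[of "card W" 0] by simp
        finally show ?thesis .
      qed
    qed
    also have "\<dots> = x * (\<Sum>W\<in>Pow ?V. x ^ card W)" by (simp add: sum_distrib_left)
    also have "\<dots> \<le> x * 3" using s3 x0 by (rule mult_left_mono)
    finally show "(\<Sum>W\<in>Pow ?V. subset_mean p ?I (\<lambda>E. of_bool (bad W E))) \<le> 3 * x" by simp
  qed
  also have "\<dots> \<le> 13 / real n"
  proof -
    have "x \<le> exp (- \<Lambda>)" using par(2) by (simp add: x_def)
    then have "x \<le> 1 / real n" using n0 by (simp add: exp_minus expL inverse_eq_divide)
    then show ?thesis by simp
  qed
  finally show ?thesis by simp
qed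

section \<open>Choice of the parameter\<close>

text \<open>
  The inequalities in \<open>n\<close> alone that enter the choice of \<open>\<delta>\<close>. The powers of \<open>n\<close> are bounds for the
  quantities in question: \<open>p \<le> n\<^bsup>-1/3\<^esup>\<close>, \<open>n p\<^sup>2 \<le> n\<^bsup>1/3\<^esup>\<close>, \<open>n\<^bsup>1-\<delta>\<^esup> p \<ge> n\<^bsup>1/2\<^esup>\<close> and \<open>n\<^bsup>1-\<delta>\<^esup> p\<^sup>2 \<ge> n\<^bsup>1/10\<^esup>\<close>.
\<close>

definition large :: "nat \<Rightarrow> bool" where
  "large n \<longleftrightarrow> 6912 \<le> ln (real n) \<and> 1 \<le> ln (ln (real n)) \<and>
     20000 * ln (real n) ^ 4 * (4 * real n powr (1/3) + 3 * ln (real n)) \<le> real n powr (1/2) / (2 * ln (real n)) \<and>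
     62208 * ln (real n) \<le> real n powr (1/10) / (2 * ln (real n)) \<and>
     4 * real n powr (-1/3) * ln (real n) < 1 \<and> 8 * ln (real n) \<le> real n powr (1/2) \<and>
     256 * (ln (real n))\<^sup>2 \<le> real n powr (1/2) \<and> real n powr (-1/3) \<le> 1/4"

lemma eventually_large: "eventually large sequentially"
  unfolding large_def by (intro eventually_conj; real_asymp)

text \<open>
  From \<open>p \<le> n\<^bsup>-1/3\<^esup>\<close> one gets \<open>\<epsilon> \<le> 1/15\<close>, so \<open>\<delta> \<le> 1/6\<close> and \<open>n\<^bsup>1-\<delta>\<^esup> p \<ge> n\<^bsup>1/2\<^esup>\<close>, which makes \<open>\<tau>\<close> small.
  Moreover \<open>s \<le> log n / p\<close>, since \<open>log (1 / (1 - p)) \<ge> p\<close>; so \<open>l\<close> is a lower bound for \<open>ell1\<close>. The choice of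
  \<open>\<delta>\<close> makes \<open>l\<^sup>2 p\<^sup>3\<close> exactly \<open>(log n)\<^sup>2 / 4\<close>.
\<close>

lemma parameter_estimates:
  fixes n :: nat and p \<epsilon> \<omega> \<delta> :: real
  defines "\<Lambda> \<equiv> ln (real n)"
  defines "l \<equiv> real n powr (1 - \<delta>) * p / (2 * \<Lambda>)"
  assumes large: "large n" and p: "p = real n powr (- 2/5 + \<epsilon>)"
    and lower: "\<Lambda> powr \<omega> * real n powr (- 2/5) \<le> p"
    and upper: "p \<le> 1/20 * real n powr (- 1/3)"
    and \<omega>: "2 \<le> \<omega>" and \<delta>: "\<delta> = 5 * \<epsilon> / 2 - 2 * ln \<Lambda> / \<Lambda>"
  shows "\<omega> * ln \<Lambda> \<le> \<epsilon> * \<Lambda>" "0 < \<delta>" "\<delta> < 1" "real n powr (1/2) \<le> real n powr (1 - \<delta>) * p"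
    "2 \<le> s_param n p \<delta>" "admissible n p l" "\<And>W. l \<le> ell1 n p \<delta> W"
proof -
  have lg: "6912 \<le> \<Lambda>" "1 \<le> ln \<Lambda>"
     "20000 * \<Lambda> ^ 4 * (4 * real n powr (1/3) + 3 * \<Lambda>) \<le> real n powr (1/2) / (2 * \<Lambda>)"
     "62208 * \<Lambda> \<le> real n powr (1/10) / (2 * \<Lambda>)"
     "4 * real n powr (-1/3) * \<Lambda> < 1" "8 * \<Lambda> \<le> real n powr (1/2)"
     "256 * \<Lambda>\<^sup>2 \<le> real n powr (1/2)" "real n powr (-1/3) \<le> 1/4"
    using large by (simp_all add: large_def \<Lambda>_def)
  have n1: "1 < real n"
  proof (rule ccontr)
    assume "\<not> 1 < real n"
    then have "\<Lambda> \<le> 0" by (cases "n = 0") (auto simp: \<Lambda>_def)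
    then show False using lg(1) by simp
  qed
  have pw: "real n powr a = exp (a * \<Lambda>)" for a
    using n1 by (simp add: powr_def \<Lambda>_def)
  have p0: "0 < p" using n1 by (simp add: p)
  have p3: "p \<le> real n powr (- 1/3)" using upper powr_ge_zero[of "real n" "- 1/3"] by linarith
  show \<epsilon>: "\<omega> * ln \<Lambda> \<le> \<epsilon> * \<Lambda>"
  proof -
    have "\<Lambda> powr \<omega> * real n powr (- 2/5) = exp (\<omega> * ln \<Lambda> + (- 2/5) * \<Lambda>)"
      using lg(1) by (simp add: pw powr_def[of \<Lambda>] flip: exp_add)
    moreover have "p = exp ((- 2/5 + \<epsilon>) * \<Lambda>)" by (simp add: p pw)
    ultimately show ?thesis using lower by (simp add: algebra_simps)
  qed
  have \<epsilon>15: "\<epsilon> \<le> 1/15"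
  proof -
    have "(- 2/5 + \<epsilon>) * \<Lambda> \<le> (- 1/3) * \<Lambda>" using p3 unfolding p pw by simp
    then have "- 2/5 + \<epsilon> \<le> - 1/3" by (rule mult_right_le_imp_le) (use lg(1) in simp)
    then show ?thesis by simp
  qed
  have \<delta>\<Lambda>: "\<delta> * \<Lambda> = 5/2 * (\<epsilon> * \<Lambda>) - 2 * ln \<Lambda>" using lg(1) by (simp add: \<delta> field_simps)
  have \<delta>1: "1 \<le> \<delta> * \<Lambda>"
  proof -
    have "2 * ln \<Lambda> \<le> \<omega> * ln \<Lambda>" using \<omega> lg(2) by (intro mult_right_mono) auto
    then show ?thesis using \<epsilon> lg(2) \<delta>\<Lambda> by linarith
  qed
  show \<delta>0: "0 < \<delta>"
  proof (rule ccontr)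
    assume "\<not> 0 < \<delta>"
    then have "\<delta> * \<Lambda> \<le> 0" using lg(1) by (simp add: mult_nonpos_nonneg)
    then show False using \<delta>1 by simp
  qed
  have \<delta>e: "\<delta> \<le> 5 * \<epsilon> / 2" using lg(1,2) by (simp add: \<delta>)
  then show \<delta>lt: "\<delta> < 1" using \<epsilon>15 by simp
  show half: "real n powr (1/2) \<le> real n powr (1 - \<delta>) * p"
  proof -
    have "real n powr (1 - \<delta>) * p = real n powr (1 - \<delta> + (- 2/5 + \<epsilon>))"
      unfolding p by (rule powr_add[symmetric])
    moreover have "real n powr (1/2) \<le> real n powr (1 - \<delta> + (- 2/5 + \<epsilon>))"
      using n1 \<delta>e \<epsilon>15 by (intro powr_mono) auto
    ultimately show ?thesis by simp
  qed
  have p4: "p \<le> 1/4" using p3 lg(8) by simp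
  define L where "L = - ln (1 - p)"
  have L: "p \<le> L" "L \<le> 2 * p"
  proof -
    have "ln (1 - p) \<le> - p" using ln_add_one_self_le_self2[of "- p"] p4 by simp
    then show "p \<le> L" by (simp add: L_def)
    have "- p - 2 * p\<^sup>2 \<le> ln (1 - p)" using ln_one_minus_pos_lower_bound[of p] p0 p4 by simp
    moreover have "2 * p\<^sup>2 \<le> p"
    proof -
      have "(2 * p) * p \<le> 1 * p" using p4 p0 by (intro mult_right_mono) auto
      then show ?thesis by (simp add: power2_eq_square)
    qed
    ultimately show "L \<le> 2 * p" by (simp add: L_def)
  qed
  have log: "\<delta> * log (1 / (1 - p)) (real n) = \<delta> * \<Lambda> / L"
    using p4 by (simp add: log_def L_def \<Lambda>_def ln_div)
  have L0: "0 < L" using L p0 by simp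
  show s2: "2 \<le> s_param n p \<delta>"
  proof -
    have "2 \<le> 1 / (2 * p)" using p0 p4 by (simp add: field_simps)
    also have "\<dots> \<le> 1 / L" using L L0 by (intro divide_left_mono) auto
    also have "\<dots> \<le> \<delta> * \<Lambda> / L" using \<delta>1 L0 by (intro divide_right_mono) auto
    finally show ?thesis unfolding s_param_def log by (simp add: le_floor_iff)
  qed
  have s: "real_of_int (s_param n p \<delta>) \<le> \<Lambda> / p"
  proof -
    have "real_of_int (s_param n p \<delta>) \<le> \<delta> * \<Lambda> / L" unfolding s_param_def log by simp
    also have "\<dots> \<le> 1 * \<Lambda> / p"
      using \<delta>0 \<delta>lt lg(1) L p0 by (intro frac_le mult_right_mono) auto
    finally show ?thesis by simp
  qed
  have \<tau>: "tau n p \<delta> \<le> 1/2"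
  proof -
    have "real n powr (1/2) \<le> real n * p"
    proof -
      have "real n powr (1 - \<delta>) \<le> real n powr 1" using n1 \<delta>0 by (intro powr_mono) auto
      then have "real n powr (1 - \<delta>) * p \<le> real n * p" using n1 p0 by (intro mult_right_mono) auto
      then show ?thesis using half by simp
    qed
    then have np: "8 * \<Lambda> \<le> real n * p" using lg(6) by simp
    then have np0: "0 < real n * p" using lg(1) by simp
    have 1: "2 * \<Lambda> / (real n * p) \<le> 1/2"
      using np np0 lg(1) by (simp add: divide_le_eq)
    have q: "1/2 \<le> 1 - \<Lambda> / (real n * p)" using 1 by simp
    have "128 * \<Lambda>\<^sup>2 \<le> real n powr (1/2) * (1/2)" using lg(7) by simp
    also have "\<dots> \<le> (real n powr (1 - \<delta>) * p) * (1 - \<Lambda> / (real n * p))"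
      using half q p0 by (intro mult_mono) auto
    finally have d: "128 * \<Lambda>\<^sup>2 \<le> real n powr (1 - \<delta>) * p * (1 - \<Lambda> / (real n * p))" .
    moreover have "0 < 128 * \<Lambda>\<^sup>2" using lg(1) by simp
    ultimately have "32 * \<Lambda>\<^sup>2 / (real n powr (1 - \<delta>) * p * (1 - \<Lambda> / (real n * p))) \<le> (1/2)\<^sup>2"
      by (simp add: divide_le_eq power2_eq_square)
    then have "sqrt (32 * \<Lambda>\<^sup>2 / (real n powr (1 - \<delta>) * p * (1 - \<Lambda> / (real n * p)))) \<le> 1/2"
      by (intro real_le_lsqrt) auto
    then show ?thesis using 1 unfolding tau_def \<Lambda>_def by simp
  qed
  show "l \<le> ell1 n p \<delta> W" for W
  proof -
    let ?s = "real_of_int (s_param n p \<delta>)"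
    have s0: "0 < ?s" using s2 by simp
    have "l = (1/2) * real n powr (1 - \<delta>) / (\<Lambda> / p)" by (simp add: l_def)
    also have "\<dots> \<le> (1 - tau n p \<delta>) * real n powr (1 - \<delta>) / ?s"
      using \<tau> s s0 by (intro frac_le mult_right_mono) auto
    also have "\<dots> \<le> ell1 n p \<delta> W" by (simp add: ell1_def)
    finally show ?thesis .
  qed
  have l: "real n powr (1/2) / (2 * \<Lambda>) \<le> l"
    unfolding l_def using half lg(1) by (intro divide_right_mono) auto
  have sq: "l\<^sup>2 * p ^ 3 = \<Lambda>\<^sup>2 / 4"
  proof -
    have "l\<^sup>2 * p ^ 3 = (real n powr (1 - \<delta>))\<^sup>2 * p ^ 5 / (4 * \<Lambda>\<^sup>2)"
      by (simp add: l_def power_divide power_mult_distrib eval_nat_numeral)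
    also have "(real n powr (1 - \<delta>))\<^sup>2 * p ^ 5 = exp (2 * ((1 - \<delta>) * \<Lambda>) + 5 * ((- 2/5 + \<epsilon>) * \<Lambda>))"
      unfolding p pw exp_add using exp_of_nat_mult[of 2 "(1 - \<delta>) * \<Lambda>"]
        exp_of_nat_mult[of 5 "(- 2/5 + \<epsilon>) * \<Lambda>"] by simp
    also have "2 * ((1 - \<delta>) * \<Lambda>) + 5 * ((- 2/5 + \<epsilon>) * \<Lambda>) = 5 * (\<epsilon> * \<Lambda>) - 2 * (\<delta> * \<Lambda>)"
      by (simp add: algebra_simps)
    also have "\<dots> = 4 * ln \<Lambda>" by (simp add: \<delta>\<Lambda>)
    also have "exp (4 * ln \<Lambda>) = \<Lambda> ^ 4" using exp_of_nat_mult[of 4 "ln \<Lambda>"] lg(1) by simp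
    finally show ?thesis using lg(1) by (simp add: eval_nat_numeral)
  qed
  show "admissible n p l"
    unfolding admissible_def \<Lambda>_def[symmetric]
  proof (intro conjI)
    show "0 < p" by (rule p0)
    show "1000 \<le> \<Lambda>" using lg(1) by simp
    have "real n powr (1/10) / (2 * \<Lambda>) \<le> p * (real n powr (1/2) / (2 * \<Lambda>))"
    proof -
      have "0 < \<epsilon>" using \<delta>0 \<delta>e by simp
      then have "real n powr (1/10) \<le> real n powr (- 2/5 + \<epsilon> + 1/2)"
        using n1 by (intro powr_mono) auto
      then have "real n powr (1/10) \<le> p * real n powr (1/2)"
        unfolding p powr_add[symmetric] .
      then have "real n powr (1/10) / (2 * \<Lambda>) \<le> p * real n powr (1/2) / (2 * \<Lambda>)"
        using lg(1) by (intro divide_right_mono) auto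
      then show ?thesis by simp
    qed
    also have "\<dots> \<le> p * l" using l p0 by (intro mult_left_mono) auto
    finally show "62208 * \<Lambda> \<le> p * l" using lg(4) by simp
    have "6912 * \<Lambda> \<le> \<Lambda> * \<Lambda>" using lg(1) by (intro mult_right_mono) auto
    then show "1728 * \<Lambda> \<le> l\<^sup>2 * p ^ 3" unfolding sq by (simp add: power2_eq_square)
    have "p * \<Lambda> \<le> real n powr (- 1/3) * \<Lambda>" using p3 lg(1) by (intro mult_right_mono) auto
    then show "4 * p * \<Lambda> < 1" using lg(5) by simp
    have "real n * p ^ 3 \<le> real n * (1/20 * real n powr (- 1/3)) ^ 3"
      using p0 upper n1 by (intro mult_left_mono power_mono) auto
    also have "\<dots> = (real n powr 1 * (real n powr (- 1/3)) ^ 3) / 8000"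
      using n1 by (simp add: power_mult_distrib power_divide eval_nat_numeral)
    also have "real n powr 1 * (real n powr (- 1/3)) ^ 3 = 1"
      using n1 by (simp add: powr_power flip: powr_add)
    finally show "2000 * real n * p ^ 3 \<le> 1" by simp
    have "real n * p\<^sup>2 \<le> real n * (real n powr (- 1/3))\<^sup>2"
      using p0 p3 n1 by (intro mult_left_mono power_mono) auto
    also have "\<dots> = real n powr 1 * real n powr (- 2/3)" using n1 by (simp add: powr_power)
    also have "\<dots> = real n powr (1/3)" by (subst powr_add[symmetric]) simp
    finally have "20000 * \<Lambda> ^ 4 * (4 * real n * p\<^sup>2 + 3 * \<Lambda>) \<le> 20000 * \<Lambda> ^ 4 * (4 * real n powr (1/3) + 3 * \<Lambda>)"
      using lg(1) by (intro mult_left_mono) auto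
    also have "\<dots> \<le> l" using lg(3) l by simp
    finally show "20000 * \<Lambda> ^ 4 * (4 * real n * p\<^sup>2 + 3 * \<Lambda>) \<le> l" .
  qed
qed

theorem theorem1p6:
  fixes p \<omega> \<epsilon> :: "nat \<Rightarrow> real"
  assumes "\<And>n. 0 < p n \<and> p n < 1"
    and "filterlim \<omega> at_top sequentially"
    and "\<forall>\<^sub>F n in sequentially.
           ln (real n) powr \<omega> n * real n powr (- 2 / 5) \<le> p n"
    and "p \<in> o(\<lambda>n. real n powr (- 1 / 3))"
    and "\<forall>\<^sub>F n in sequentially.
           p n = real n powr (- 2 / 5 + \<epsilon> n) \<and> \<epsilon> n > 0"
  shows "\<exists>\<delta> :: nat \<Rightarrow> real.
     \<delta> \<sim>[sequentially] (\<lambda>n. 5 * \<epsilon> n / 2) \<and>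
     (\<forall>n. 0 < \<delta> n \<and> \<delta> n < 1) \<and>
     (\<lambda>n. (ln (real n))\<^sup>2) \<in> o(\<lambda>n. real n powr (1 - \<delta> n) * p n) \<and>
     (\<forall>\<^sub>F n in sequentially. s_param n (p n) (\<delta> n) \<ge> 2) \<and>
     (\<lambda>n. measure_pmf.prob (Gnp n (p n))
        {E. \<forall>W. useful n (p n) (\<delta> n) E W \<longrightarrow>
               (\<exists>K \<subseteq> W. clique K E \<and>
                  (\<forall>v \<in> verts n - W. nonneighbors E v K \<noteq> {}))})
       \<longlonglongrightarrow> 1"
proof -
  define d where "d n = 5 * \<epsilon> n / 2 - 2 * ln (ln (real n)) / ln (real n)" for n
  \<comment> \<open>the value \<open>1/2\<close> is only a default for the finitely many \<open>n\<close> with \<open>d n\<close> outside the unit interval\<close>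
  define \<delta> where "\<delta> n = (if 0 < d n \<and> d n < 1 then d n else 1/2)" for n
  define l where "l n = real n powr (1 - \<delta> n) * p n / (2 * ln (real n))" for n
  have upper: "\<forall>\<^sub>F n in sequentially. p n \<le> 1/20 * real n powr (- 1/3)"
    using landau_o.smallD[OF assms(4), of "1/20"] assms(1) by (simp add: less_imp_le)
  have om: "\<forall>\<^sub>F n in sequentially. c \<le> \<omega> n" for c
    using assms(2) by (simp add: filterlim_at_top)
  have est: "\<forall>\<^sub>F n in sequentially. large n \<and> \<delta> n = d n \<and> \<omega> n * ln (ln (real n)) \<le> \<epsilon> n * ln (real n) \<and>
      real n powr (1/2) \<le> real n powr (1 - \<delta> n) * p n \<and> 2 \<le> s_param n (p n) (\<delta> n) \<and>
      admissible n (p n) (l n) \<and> (\<forall>W. l n \<le> ell1 n (p n) (\<delta> n) W)"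
    using eventually_large assms(3,5) upper om[of 2]
  proof eventually_elim
    case (elim n)
    note est = parameter_estimates[where \<omega> = "\<omega> n" and p = "p n" and \<epsilon> = "\<epsilon> n" and n = n and \<delta> = "d n"]
    have p: "p n = real n powr (- 2 / 5 + \<epsilon> n)" using elim by simp
    have "0 < d n" "d n < 1"
      using est(2,3)[OF elim(1) p elim(2,4,5) d_def] by auto
    then have "\<delta> n = d n" by (simp add: \<delta>_def)
    then show ?case
      using est(1,4-7)[OF elim(1) p elim(2,4,5) d_def] elim(1) by (simp add: l_def)
  qed
  have "\<delta> \<sim>[sequentially] (\<lambda>n. 5 * \<epsilon> n / 2)"
    unfolding asymp_equiv_altdef
  proof (rule landau_o.smallI)
    fix c :: real assume c: "0 < c"
    show "\<forall>\<^sub>F n in sequentially. norm (\<delta> n - 5 * \<epsilon> n / 2) \<le> c * norm (5 * \<epsilon> n / 2)"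
      using est om[of "4 / (5 * c)"]
    proof eventually_elim
      case (elim n)
      define L M where "L = ln (real n)" and "M = ln (ln (real n))"
      have LM: "6912 \<le> L" "1 \<le> M" using elim(1) by (auto simp: large_def L_def M_def)
      have "4 / (5 * c) * M \<le> \<omega> n * M" using elim(2) LM by (intro mult_right_mono) auto
      also have "\<dots> \<le> \<epsilon> n * L" using elim(1) by (simp add: L_def M_def)
      finally have "4 * M \<le> 5 * c * (\<epsilon> n * L)" using c by (simp add: field_simps)
      then have "2 * M / L \<le> c * (5 * \<epsilon> n / 2)" using LM by (simp add: field_simps)
      moreover have "\<delta> n - 5 * \<epsilon> n / 2 = - (2 * M / L)" using elim(1) by (simp add: d_def L_def M_def)
      moreover have "0 \<le> 2 * M / L" using LM by simp
      moreover have "c * (5 * \<epsilon> n / 2) \<le> c * norm (5 * \<epsilon> n / 2)"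
        using c by (intro mult_left_mono) auto
      ultimately show ?case by simp
    qed
  qed
  moreover have "\<forall>n. 0 < \<delta> n \<and> \<delta> n < 1" by (simp add: \<delta>_def)
  moreover have "(\<lambda>n. (ln (real n))\<^sup>2) \<in> o(\<lambda>n. real n powr (1 - \<delta> n) * p n)"
  proof -
    have "(\<lambda>n. (ln (real n))\<^sup>2) \<in> o(\<lambda>n. real n powr (1/2))" by real_asymp
    also have "(\<lambda>n. real n powr (1/2)) \<in> O(\<lambda>n. real n powr (1 - \<delta> n) * p n)"
    proof (rule landau_o.big_mono)
      show "\<forall>\<^sub>F n in sequentially. norm (real n powr (1/2)) \<le> norm (real n powr (1 - \<delta> n) * p n)"
        using est by eventually_elim auto
    qed
    finally show ?thesis .
  qed
  moreover have "\<forall>\<^sub>F n in sequentially. s_param n (p n) (\<delta> n) \<ge> 2"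
    using est by eventually_elim auto
  moreover have "(\<lambda>n. measure_pmf.prob (Gnp n (p n))
        {E. \<forall>W. useful n (p n) (\<delta> n) E W \<longrightarrow>
               (\<exists>K \<subseteq> W. clique K E \<and>
                  (\<forall>v \<in> verts n - W. nonneighbors E v K \<noteq> {}))})
       \<longlonglongrightarrow> 1" (is "(\<lambda>n. measure_pmf.prob _ (?X n)) \<longlonglongrightarrow> 1")
  proof (rule tendsto_sandwich[where h = "\<lambda>_. 1"])
    show "\<forall>\<^sub>F n in sequentially. 1 - 13 / real n \<le> measure_pmf.prob (Gnp n (p n)) (?X n)"
      using est
    proof eventually_elim
      case (elim n)
      have "1 - 13 / real n \<le> measure_pmf.prob (Gnp n (p n))
        {E. \<forall>W\<subseteq>verts n. verts n - W \<noteq> {} \<longrightarrow> (\<forall>v\<in>verts n - W. l n \<le> real (card (nonneighbors E v W))) \<longrightarrow>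
           (\<exists>K\<subseteq>W. clique K E \<and> (\<forall>v\<in>verts n - W. nonneighbors E v K \<noteq> {}))}"
        using elim by (intro hitting_clique_prob) simp
      also have "\<dots> \<le> measure_pmf.prob (Gnp n (p n)) (?X n)"
      proof (intro measure_pmf.finite_measure_mono subsetI CollectI allI impI)
        fix E W
        assume E: "E \<in> {E. \<forall>W\<subseteq>verts n. verts n - W \<noteq> {} \<longrightarrow> (\<forall>v\<in>verts n - W. l n \<le> real (card (nonneighbors E v W))) \<longrightarrow>
           (\<exists>K\<subseteq>W. clique K E \<and> (\<forall>v\<in>verts n - W. nonneighbors E v K \<noteq> {}))}"
          and u: "useful n (p n) (\<delta> n) E W"
        have "W \<subseteq> verts n" "1 \<le> int (card (verts n - W))" using u by (auto simp: useful_def)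
        moreover from this(2) have "verts n - W \<noteq> {}" by (metis card.empty of_nat_0 not_one_le_zero)
        moreover have "l n \<le> real (card (nonneighbors E v W))" if "v \<in> verts n - W" for v
        proof -
          have "l n \<le> ell1 n (p n) (\<delta> n) W" using elim by blast
          also have "\<dots> \<le> real (card (nonneighbors E v W))" using u that unfolding useful_def by blast
          finally show ?thesis .
        qed
        ultimately show "\<exists>K\<subseteq>W. clique K E \<and> (\<forall>v\<in>verts n - W. nonneighbors E v K \<noteq> {})"
          using E by blast
      qed simp
      finally show ?case .
    qed
    show "(\<lambda>n. 1 - 13 / real n) \<longlonglongrightarrow> 1" by real_asymp
  qed (auto intro!: always_eventually measure_pmf.prob_le_1)
  ultimately show ?thesis by blast
qed

end
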